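(* Let $A\in\mathbb R^{n\times n}$, $B\in\mathbb R^{n\times m}$, $C\in\mathbb R^{p\times n}$, let $D\in\mathbb R^{q\times n}$ with $q\le n$ have full row rank, and assume that $(A,B)$ is reachable and $(C,A)$ is observable. Let $N\ge n$, and let $\tau_N$ be the threshold defined in the context. Let $G\in\mathbb R^{n\times p}$ be such that $A-GC$ is stable, let $r$ denote the spectral radius of $A-GC$, let $1<\rho<1/r$, and let $\Sigma_\rho$ and $\beta_\rho$ be as defined in the context. If $0\le\theta<\tau_N$ and $\theta\le\beta_\rho$, then the risk-sensitive Riccati map $$r^\theta(P)=A[P^{-1}+C^TC-\theta D^TD]^{-1}A^T+BB^T$$ has a unique positive definite fixed point $P$ such that $P^{-1}-\theta D^TD>0$. Furthermore, if $0<P_0\le\Sigma_\rho$, then the entire trajectory of the iteration $P_{t+1}=r^\theta(P_t)$, $t\ge 0$, stays in the cone $\mathcal P$ of positive definite matrices, satisfies $V_t=(P_t^{-1}-\theta D^TD)^{-1}>0$ for all $t$, and tends to $P$ as $t\to\infty$. In this case, the limit $K$ as $t\to\infty$ of the filtering gain $$K_t=A(P_t^{-1}-\theta D^TD)^{-1}C^T\left[C(P_t^{-1}-\theta D^TD)^{-1}C^T+I_p\right]^{-1}$$ has the property that $A-KC$ is stable.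
   Context: All matrices are real. $\mathcal P$ is the cone of $n\times n$ symmetric positive definite matrices; $\ge$, $>$ denote the Loewner partial order on symmetric matrices; $\lambda_1(\cdot)$ is the largest eigenvalue. A square matrix is stable if all its eigenvalues lie strictly inside the unit circle. Block matrices. For $N\ge1$ put $$\mathcal O_N=\begin{bmatrix}(CA^{N-1})^T&\cdots&(CA)^T&C^T\end{bmatrix}^T,\qquad \mathcal O_N^R=\begin{bmatrix}(DA^{N-1})^T&\cdots&(DA)^T&D^T\end{bmatrix}^T.$$ Let $H_t=CA^{t-1}B$ and $L_t=DA^{t-1}B$ for $t\ge1$, and $H_t=0$, $L_t=0$ for $t\le0$. $\mathcal H_N$ is the $Np\times Nm$ block Toeplitz matrix whose $(i,j)$ block is $H_{j-i}$, and $\mathcal L_N$ is the $Nq\times Nm$ block Toeplitz matrix whose $(i,j)$ block is $L_{j-i}$, $1\le i,j\le N$ (both strictly block upper triangular). Thresholds. Let $$\theta_N=1/\lambda_1\big(\mathcal L_N(I_{Nm}+\mathcal H_N^T\mathcal H_N)^{-1}\mathcal L_N^T\big)$$ (with $\theta_N=\infty$ if $\mathcal L_N=0$), $$\Omega_N=\mathcal O_N^T[I_{Np}+\mathcal H_N\mathcal H_N^T]^{-1}\mathcal O_N,\qquad \mathcal J_N=\mathcal O_N^R-\mathcal L_N\mathcal H_N^T[I_{Np}+\mathcal H_N\mathcal H_N^T]^{-1}\mathcal O_N,$$ and for $0<\theta<\theta_N$, $$S_N^\theta=-\theta^{-1}I_{Nq}+\mathcal L_N(I_{Nm}+\mathcal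 H_N^T\mathcal H_N)^{-1}\mathcal L_N^T,\qquad \Omega_N^\theta=\Omega_N+\mathcal J_N^T(S_N^\theta)^{-1}\mathcal J_N,$$ with $\Omega_N^0=\Omega_N$. The number $\tau_N<\theta_N$ is the first (smallest) value of $\theta$ for which $\Omega_N^\theta$ becomes singular. Observer quantities. For $G$ with $A-GC$ stable with spectral radius $r$, and $1<\rho<1/r$ (where $1/r=\infty$ if $r=0$), $\Sigma_\rho$ is the unique solution, which is positive definite, of the Lyapunov equation $$\Sigma_\rho=\rho^2(A-GC)\Sigma_\rho(A-GC)^T+BB^T+GG^T,$$ and $$\beta_\rho=\frac{\rho^2-1}{\rho^2\lambda_1(D\Sigma_\rho D^T)}.$$ *)

theory Defs
  imports "HOL-Analysis.Analysis"
begin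

text \<open>The library's \<open>*\<close> and \<open>^\<close> on square matrices act entrywise, hence a separate power
  for the matrix product.\<close>

primrec matpow :: "'a::semiring_1^'n^'n \<Rightarrow> nat \<Rightarrow> 'a^'n^'n" where
  "matpow A 0 = mat 1"
| "matpow A (Suc k) = A ** matpow A k"

definition eigenvalues :: "'a::field^'n^'n \<Rightarrow> 'a set" where
  "eigenvalues M = {c. \<exists>v. v \<noteq> 0 \<and> M *v v = c *s v}"

definition complex_eigenvalues :: "real^'n^'n \<Rightarrow> complex set" where
  "complex_eigenvalues M = eigenvalues (map_matrix complex_of_real M)"

definition schur_stable :: "real^'n^'n \<Rightarrow> bool" where
  "schur_stable M \<longleftrightarrow> (\<forall>c\<in>complex_eigenvalues M. cmod c < 1)"

definition spec_radius :: "real^'n^'n \<Rightarrow> real" where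
  "spec_radius M = Max (cmod ` complex_eigenvalues M)"

text \<open>Only applied to symmetric matrices, all of whose eigenvalues are real.\<close>

definition lambda_max :: "real^'n^'n \<Rightarrow> real" where
  "lambda_max M = Max (eigenvalues M)"

definition pos_semidef :: "real^'n^'n \<Rightarrow> bool" where
  "pos_semidef M \<longleftrightarrow> transpose M = M \<and> (\<forall>x. 0 \<le> x \<bullet> (M *v x))"

definition pos_def :: "real^'n^'n \<Rightarrow> bool" where
  "pos_def M \<longleftrightarrow> transpose M = M \<and> (\<forall>x. x \<noteq> 0 \<longrightarrow> 0 < x \<bullet> (M *v x))"

definition loewner_le :: "real^'n^'n \<Rightarrow> real^'n^'n \<Rightarrow> bool" where
  "loewner_le M M' \<longleftrightarrow> pos_semidef (M' - M)"

text \<open>Kalman's rank conditions: the union below is the set of columns of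
  \<open>[B, A B, \<dots>, A\<^sup>n\<^sup>-\<^sup>1 B]\<close>, respectively the set of rows of the stacked matrix with
  blocks \<open>C, C A, \<dots>, C A\<^sup>n\<^sup>-\<^sup>1\<close>, so its dimension is the rank of that matrix.\<close>

definition is_reachable :: "real^'n^'n \<Rightarrow> real^'m^'n \<Rightarrow> bool" where
  "is_reachable A B \<longleftrightarrow> dim (\<Union>k<CARD('n). columns (matpow A k ** B)) = CARD('n)"

definition is_observable :: "real^'n^'p \<Rightarrow> real^'n^'n \<Rightarrow> bool" where
  "is_observable C A \<longleftrightarrow> dim (\<Union>k<CARD('n). rows (C ** matpow A k)) = CARD('n)"

text \<open>An \<open>N \<times> N\<close> arrangement of blocks is indexed by a finite linearly ordered type \<open>'k\<close>
  with \<open>N = CARD('k)\<close>; row \<open>(i, a)\<close> is row \<open>a\<close> of block row \<open>i\<close>. The 1-based position of a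
  block index is its rank in the order.\<close>

definition pos :: "'k::{finite,linorder} \<Rightarrow> nat" where
  "pos i = card {j. j \<le> i}"

definition markov :: "real^'n^'p \<Rightarrow> real^'n^'n \<Rightarrow> real^'m^'n \<Rightarrow> int \<Rightarrow> real^'m^'p" where
  "markov C A B t = (if t \<ge> 1 then C ** matpow A (nat (t - 1)) ** B else 0)"

definition obs_block :: "real^'n^'p \<Rightarrow> real^'n^'n \<Rightarrow> real^'n^('k::{finite,linorder} \<times> 'p)" where
  "obs_block C A = (\<chi> r. (C ** matpow A (CARD('k) - pos (fst r))) $ snd r)"

definition toeplitz_block ::
  "real^'n^'p \<Rightarrow> real^'n^'n \<Rightarrow> real^'m^'n \<Rightarrow> real^('k \<times> 'm)^('k::{finite,linorder} \<times> 'p)" where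
  "toeplitz_block C A B =
     (\<chi> r s. markov C A B (int (pos (fst s)) - int (pos (fst r))) $ snd r $ snd s)"

text \<open>The quantities below whose type does not mention \<open>'k\<close> take it as a type argument.\<close>

definition LL_N :: "real^'n^'n \<Rightarrow> real^'m^'n \<Rightarrow> real^'n^'p \<Rightarrow> real^'n^'q
    \<Rightarrow> real^('k \<times> 'q)^('k::{finite,linorder} \<times> 'q)" where
  "LL_N A B C D =
    (let H = toeplitz_block C A B :: real^('k \<times> 'm)^('k \<times> 'p);
         L = toeplitz_block D A B :: real^('k \<times> 'm)^('k \<times> 'q)
     in L ** matrix_inv (mat 1 + transpose H ** H) ** transpose L)"

definition theta_N :: "'k::{finite,linorder} itself
    \<Rightarrow> real^'n^'n \<Rightarrow> real^'m^'n \<Rightarrow> real^'n^'p \<Rightarrow> real^'n^'q \<Rightarrow> ereal" where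
  "theta_N _ A B C D =
    (if (toeplitz_block D A B :: real^('k \<times> 'm)^('k \<times> 'q)) = 0 then \<infinity>
     else ereal (1 / lambda_max (LL_N A B C D :: real^('k \<times> 'q)^('k \<times> 'q))))"

definition Omega_N :: "'k::{finite,linorder} itself
    \<Rightarrow> real^'n^'n \<Rightarrow> real^'m^'n \<Rightarrow> real^'n^'p \<Rightarrow> real^'n^'n" where
  "Omega_N _ A B C =
    (let Ob = obs_block C A :: real^'n^('k \<times> 'p);
         H = toeplitz_block C A B :: real^('k \<times> 'm)^('k \<times> 'p)
     in transpose Ob ** matrix_inv (mat 1 + H ** transpose H) ** Ob)"

definition J_N :: "real^'n^'n \<Rightarrow> real^'m^'n \<Rightarrow> real^'n^'p \<Rightarrow> real^'n^'q
    \<Rightarrow> real^'n^('k::{finite,linorder} \<times> 'q)" where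
  "J_N A B C D =
    (let Ob = obs_block C A :: real^'n^('k \<times> 'p);
         ObR = obs_block D A :: real^'n^('k \<times> 'q);
         H = toeplitz_block C A B :: real^('k \<times> 'm)^('k \<times> 'p);
         L = toeplitz_block D A B :: real^('k \<times> 'm)^('k \<times> 'q)
     in ObR - L ** transpose H ** matrix_inv (mat 1 + H ** transpose H) ** Ob)"

definition S_N :: "real \<Rightarrow> real^'n^'n \<Rightarrow> real^'m^'n \<Rightarrow> real^'n^'p \<Rightarrow> real^'n^'q
    \<Rightarrow> real^('k \<times> 'q)^('k::{finite,linorder} \<times> 'q)" where
  "S_N \<theta> A B C D = - ((1 / \<theta>) *\<^sub>R mat 1) + LL_N A B C D"

definition Omega_theta :: "'k::{finite,linorder} itself \<Rightarrow> real
    \<Rightarrow> real^'n^'n \<Rightarrow> real^'m^'n \<Rightarrow> real^'n^'p \<Rightarrow> real^'n^'q \<Rightarrow> real^'n^'n" where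
  "Omega_theta _ \<theta> A B C D =
    (if \<theta> = 0 then Omega_N TYPE('k) A B C
     else (let J = J_N A B C D :: real^'n^('k \<times> 'q);
               S = S_N \<theta> A B C D :: real^('k \<times> 'q)^('k \<times> 'q)
           in Omega_N TYPE('k) A B C + transpose J ** matrix_inv S ** J))"

definition singular_values_N :: "'k::{finite,linorder} itself
    \<Rightarrow> real^'n^'n \<Rightarrow> real^'m^'n \<Rightarrow> real^'n^'p \<Rightarrow> real^'n^'q \<Rightarrow> real set" where
  "singular_values_N _ A B C D =
    {\<theta>. 0 \<le> \<theta> \<and> ereal \<theta> < theta_N TYPE('k) A B C D \<and>
        \<not> invertible (Omega_theta TYPE('k) \<theta> A B C D)}"

text \<open>If \<open>\<Omega>\<^sub>N\<^sup>\<theta>\<close> becomes singular on the interval of \<open>\<theta>\<close> where it is defined, the threshold is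
  the first such \<open>\<theta>\<close>. For singular \<open>A\<close> it may stay nonsingular on the whole interval; the
  threshold is then the right end of the interval.\<close>

definition tau_N :: "'k::{finite,linorder} itself
    \<Rightarrow> real^'n^'n \<Rightarrow> real^'m^'n \<Rightarrow> real^'n^'p \<Rightarrow> real^'n^'q \<Rightarrow> ereal" where
  "tau_N _ A B C D =
    (if singular_values_N TYPE('k) A B C D = {} then theta_N TYPE('k) A B C D
     else ereal (LEAST \<theta>. \<theta> \<in> singular_values_N TYPE('k) A B C D))"

definition Sigma_rho :: "real \<Rightarrow> real^'n^'n \<Rightarrow> real^'m^'n \<Rightarrow> real^'n^'p \<Rightarrow> real^'p^'n \<Rightarrow> real^'n^'n" where
  "Sigma_rho \<rho> A B C G =
    (THE S. S = \<rho>\<^sup>2 *\<^sub>R ((A - G ** C) ** S ** transpose (A - G ** C))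
                + B ** transpose B + G ** transpose G)"

definition beta_rho :: "real \<Rightarrow> real^'n^'n \<Rightarrow> real^'m^'n \<Rightarrow> real^'n^'p \<Rightarrow> real^'n^'q \<Rightarrow> real^'p^'n \<Rightarrow> real" where
  "beta_rho \<rho> A B C D G =
    (\<rho>\<^sup>2 - 1) / (\<rho>\<^sup>2 * lambda_max (D ** Sigma_rho \<rho> A B C G ** transpose D))"

definition riccati :: "real \<Rightarrow> real^'n^'n \<Rightarrow> real^'m^'n \<Rightarrow> real^'n^'p \<Rightarrow> real^'n^'q
    \<Rightarrow> real^'n^'n \<Rightarrow> real^'n^'n" where
  "riccati \<theta> A B C D P =
     A ** matrix_inv (matrix_inv P + transpose C ** C - \<theta> *\<^sub>R (transpose D ** D)) ** transpose A
     + B ** transpose B"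

definition V_inv :: "real \<Rightarrow> real^'n^'q \<Rightarrow> real^'n^'n \<Rightarrow> real^'n^'n" where
  "V_inv \<theta> D P = matrix_inv P - \<theta> *\<^sub>R (transpose D ** D)"

definition gain :: "real \<Rightarrow> real^'n^'n \<Rightarrow> real^'n^'p \<Rightarrow> real^'n^'q \<Rightarrow> real^'n^'n \<Rightarrow> real^'p^'n" where
  "gain \<theta> A C D P =
    (let V = matrix_inv (V_inv \<theta> D P)
     in A ** V ** transpose C ** matrix_inv (C ** V ** transpose C + mat 1))"

end

theory Submission
  imports Defs "HOL-Computational_Algebra.Fundamental_Theorem_Algebra"
begin

text \<open>
  Write \<open>X\<^sub>t = P\<^sub>t\<inverse>\<close>. In this information form one Riccati step minimizes a quadratic form: \<open>X\<^sub>t\<^sub>+\<^sub>1\<close>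
  charges a state \<open>z\<close> the least value of
  \<open>x \<bullet> X\<^sub>t x + \<bar>w\<bar>\<^sup>2 + \<bar>C x\<bar>\<^sup>2 - \<theta> \<bar>D x\<bar>\<^sup>2\<close> over all pairs with \<open>A x + B w = z\<close>
  (\<open>riccati_inv_le\<close>, \<open>riccati_inv_attained\<close>). After \<open>N\<close> steps it charges the least initial cost
  \<open>x\<^sub>0 \<bullet> X\<^sub>t x\<^sub>0\<close> plus a block cost that does not depend on \<open>X\<^sub>t\<close>. For \<open>\<theta> < \<tau>\<^sub>N\<close>
  this block cost dominates \<open>\<epsilon> \<bar>x\<^sub>0\<bar>\<^sup>2\<close> for some \<open>\<epsilon> > 0\<close>: minimizing it over the noise leaves
  the form of \<open>\<Omega>\<^sub>N\<^sup>\<theta>\<close>, which is positive definite at \<open>\<theta> = 0\<close> by observability and stays so until it first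
  becomes singular (\<open>block_cost_coercive\<close>).

  Coercivity makes \<open>N\<close> steps a contraction towards any fixed point \<open>P\<close> with
  \<open>P\<inverse> - \<theta> D\<^sup>T D > 0\<close>. If \<open>X\<^sub>t \<le> a P\<inverse>\<close> with \<open>a \<ge> 1\<close>, then along a trajectory optimal for \<open>P\<close> only the initial cost is scaled
  by \<open>a\<close>, and that cost is a fixed fraction of the total; hence \<open>X\<^sub>t\<^sub>+\<^sub>N \<le> (1 + \<kappa> (a - 1)) P\<inverse>\<close>
  with \<open>\<kappa> < 1\<close> (\<open>block_contraction\<close>). Uniqueness of the fixed point follows by symmetry.

  Existence comes from monotonicity. The condition \<open>\<theta> \<le> \<beta>\<^sub>\<rho>\<close> bounds \<open>\<theta> D\<^sup>T D\<close> by
  \<open>(1 - \<rho>\<^sup>-\<^sup>2) \<Sigma>\<^sub>\<rho>\<inverse>\<close>, and the Lyapunov equation then says that the Riccati map does not increase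
  \<open>\<Sigma>\<^sub>\<rho>\<close> (\<open>Sigma_rho_supersolution\<close>). Its orbit therefore decreases to a fixed point, positive definite by
  reachability. An orbit that starts below \<open>\<Sigma>\<^sub>\<rho>\<close> stays below that orbit, and the contraction bounds
  it from below, so it has the same limit.

  The limiting gain \<open>K\<close> satisfies \<open>P = F V F\<^sup>T + K K\<^sup>T + B B\<^sup>T\<close> with \<open>F = A - K C\<close> and
  \<open>V \<ge> P\<close>; this Lyapunov inequality and reachability exclude eigenvalues of modulus at least 1. The
  solution of the Lyapunov equation for \<open>\<Sigma>\<^sub>\<rho>\<close> rests on the fact that the powers of a stable
  matrix tend to 0, which is derived from annihilating polynomials and the fundamental theorem of algebra.
\<close>

(* Products with a transpose stay in the form \<open>E\<^sup>T v\<close>, which congruences \<open>E W E\<^sup>T\<close> produce. *)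
declare transpose_matrix_vector [simp del] vector_transpose_matrix [simp del]

section \<open>Quadratic forms and the Loewner order\<close>

definition qform :: "real^'n^'n \<Rightarrow> real^'n \<Rightarrow> real" where
  "qform M x = x \<bullet> (M *v x)"

lemma inner_transpose_mult: "x \<bullet> (transpose (M::real^'n^'m) *v y) = (M *v x) \<bullet> y"
  by (metis dot_lmul_matrix inner_commute transpose_matrix_vector)

lemma inner_mult_transpose: "(transpose (M::real^'n^'m) *v y) \<bullet> x = y \<bullet> (M *v x)"
  by (metis inner_commute inner_transpose_mult)

lemma transpose_plus: "transpose (M + N) = transpose M + transpose (N :: real^'n^'m)"
  by (simp add: transpose_def vec_eq_iff)

lemma transpose_minus: "transpose (M - N) = transpose M - transpose (N :: real^'n^'m)"
  by (simp add: transpose_def vec_eq_iff)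

lemma transpose_zero [simp]: "transpose (0 :: real^'n^'m) = 0"
  by (simp add: transpose_def vec_eq_iff)

lemma inner_symmetric_mult: "transpose M = (M :: real^'n^'n) \<Longrightarrow> x \<bullet> (M *v y) = (M *v x) \<bullet> y"
  using inner_transpose_mult[of x M y] by simp

lemma inner_symmetric_mult_commute: "transpose M = (M :: real^'n^'n) \<Longrightarrow> x \<bullet> (M *v y) = y \<bullet> (M *v x)"
  using inner_transpose_mult[of x M y] by (simp add: inner_commute)

lemma qform_plus: "qform (M + N) x = qform M x + qform N x"
  by (simp add: qform_def matrix_vector_mult_add_rdistrib inner_add_right)

lemma qform_minus: "qform (M - N) x = qform M x - qform N x"
  by (simp add: qform_def matrix_vector_mult_diff_rdistrib inner_diff_right)

lemma qform_scaleR_matrix: "qform (c *\<^sub>R M) x = c * qform M x"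
  by (simp add: qform_def scaleR_matrix_vector_assoc[symmetric])

lemma qform_scaleR: "qform M (c *\<^sub>R x) = c\<^sup>2 * qform M x"
  by (simp add: qform_def matrix_vector_mult_scaleR power2_eq_square)

lemma qform_zero_matrix [simp]: "qform 0 x = 0" and qform_zero [simp]: "qform M 0 = 0"
  by (simp_all add: qform_def)

lemma qform_mat_1 [simp]: "qform (mat 1) x = x \<bullet> x"
  by (simp add: qform_def)

lemma qform_congruence: "qform (E ** W ** transpose E) x = qform W (transpose E *v x)"
  by (simp add: qform_def inner_mult_transpose matrix_vector_mul_assoc[symmetric])

lemma qform_gram: "qform (transpose E ** E) x = (E *v x) \<bullet> (E *v x)"
  by (simp add: qform_def inner_transpose_mult matrix_vector_mul_assoc[symmetric])

lemma qform_gram': "qform (E ** transpose E) x = (transpose E *v x) \<bullet> (transpose E *v x)"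
  using qform_gram[of "transpose E"] by simp

lemma qform_add_vector:
  "transpose M = M \<Longrightarrow> qform M (x + y) = qform M x + qform M y + 2 * (x \<bullet> (M *v y))"
  by (simp add: qform_def matrix_vector_right_distrib inner_add_left inner_add_right
      inner_symmetric_mult_commute[of M x y])

lemma qform_diff_vector:
  "transpose M = M \<Longrightarrow> qform M (x - y) = qform M x + qform M y - 2 * (x \<bullet> (M *v y))"
  by (simp add: qform_def matrix_vector_mult_diff_distrib inner_diff_left inner_diff_right
      inner_symmetric_mult_commute[of M x y])

text \<open>Polarization recovers the entries of a symmetric matrix from values of its form.\<close>

lemma symmetric_entry_polarization:
  "transpose M = M \<Longrightarrow>
   M $ i $ j = (qform M (axis i 1 + axis j 1) - qform M (axis i 1) - qform M (axis j 1)) / 2"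
  by (simp add: qform_add_vector matrix_vector_mul_component matrix_vector_mult_basis column_def
      inner_axis' inner_axis)

lemma symmetric_eqI:
  assumes "transpose M = M" "transpose N = N" "\<And>x. qform M x = qform N x"
  shows "M = N"
  by (simp add: vec_eq_iff symmetric_entry_polarization[OF assms(1)]
      symmetric_entry_polarization[OF assms(2)] assms(3))

lemma tendsto_matrixI:
  assumes "\<And>i j. ((\<lambda>t. M t $ i $ j) \<longlongrightarrow> L $ i $ j) F"
  shows "((M :: _ \<Rightarrow> real^'n^'m) \<longlongrightarrow> L) F"
  by (intro vec_tendstoI assms)

lemma tendsto_symmetricI:
  assumes "\<And>t. transpose (M t) = M t" "transpose L = L"
    and "\<And>x. ((\<lambda>t. qform (M t) x) \<longlongrightarrow> qform L x) F"
  shows "(M \<longlongrightarrow> L) F"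
proof (rule tendsto_matrixI)
  show "((\<lambda>t. M t $ i $ j) \<longlongrightarrow> L $ i $ j) F" for i j
    unfolding symmetric_entry_polarization[OF assms(1)] symmetric_entry_polarization[OF assms(2)]
    by (intro tendsto_intros assms(3)) simp
qed

lemma symmetric_limit_exists:
  assumes "\<And>t. transpose (M t) = M t" "\<And>x. convergent (\<lambda>t. qform (M t) x)"
  shows "\<exists>L. transpose L = L \<and> (M :: nat \<Rightarrow> real^'n^'n) \<longlonglongrightarrow> L"
proof -
  have "convergent (\<lambda>t. M t $ i $ j)" for i j
  proof -
    have "(\<lambda>t. M t $ i $ j) \<longlonglongrightarrow>
        (lim (\<lambda>t. qform (M t) (axis i 1 + axis j 1)) - lim (\<lambda>t. qform (M t) (axis i 1))
           - lim (\<lambda>t. qform (M t) (axis j 1))) / 2"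
      unfolding symmetric_entry_polarization[OF assms(1)]
      by (intro tendsto_intros convergent_LIMSEQ_iff[THEN iffD1] assms(2)) simp
    then show ?thesis
      by (rule convergentI)
  qed
  then have lim: "(\<lambda>t. M t $ i $ j) \<longlonglongrightarrow> lim (\<lambda>t. M t $ i $ j)" for i j
    by (simp add: convergent_LIMSEQ_iff)
  define L where "L = (\<chi> i j. lim (\<lambda>t. M t $ i $ j))"
  have "M \<longlonglongrightarrow> L"
    by (rule tendsto_matrixI) (simp add: L_def lim)
  moreover have "M t $ i $ j = M t $ j $ i" for t i j
    using assms(1)[of t] by (metis (no_types) transpose_def vec_lambda_beta)
  then have "transpose L = L"
    by (simp add: L_def transpose_def vec_eq_iff)
  ultimately show ?thesis
    by blast
qed

lemma continuous_on_qform: "continuous_on S (qform M)"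
  unfolding qform_def by (intro continuous_intros)

lemma tendsto_matrix_vector_mult:
  assumes "(M \<longlongrightarrow> (L :: real^'n^'m)) F" "(v \<longlongrightarrow> u) F"
  shows "((\<lambda>t. M t *v v t) \<longlongrightarrow> L *v u) F"
  unfolding matrix_vector_mult_def
  by (intro vec_tendstoI) (auto intro!: tendsto_intros assms)

lemma tendsto_matrix_mult:
  assumes "(M \<longlongrightarrow> (L :: real^'n^'m)) F" "(N \<longlongrightarrow> K) F"
  shows "((\<lambda>t. M t ** N t) \<longlongrightarrow> L ** K) F"
  unfolding matrix_matrix_mult_def
  by (intro vec_tendstoI) (auto intro!: tendsto_intros assms)

lemma tendsto_transpose:
  assumes "(M \<longlongrightarrow> (L :: real^'n^'m)) F"
  shows "((\<lambda>t. transpose (M t)) \<longlongrightarrow> transpose L) F"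
  unfolding transpose_def by (intro vec_tendstoI) (auto intro!: tendsto_intros assms)

lemma tendsto_qform:
  assumes "(M \<longlongrightarrow> L) F" "(v \<longlongrightarrow> u) F"
  shows "((\<lambda>t. qform (M t) (v t)) \<longlongrightarrow> qform L u) F"
  unfolding qform_def by (intro tendsto_intros tendsto_matrix_vector_mult assms)

lemma pos_def_iff: "pos_def M \<longleftrightarrow> transpose M = M \<and> (\<forall>x. x \<noteq> 0 \<longrightarrow> 0 < qform M x)"
  by (simp add: pos_def_def qform_def)

lemma pos_def_symmetric: "pos_def M \<Longrightarrow> transpose M = M"
  by (simp add: pos_def_def)

lemma pos_def_pos: "pos_def M \<Longrightarrow> x \<noteq> 0 \<Longrightarrow> 0 < qform M x"
  by (simp add: pos_def_iff)

lemma pos_def_nonneg: "pos_def M \<Longrightarrow> 0 \<le> qform M x"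
  by (metis less_eq_real_def pos_def_pos qform_zero)

lemma loewner_le_iff:
  assumes "transpose M = M" "transpose N = N"
  shows "loewner_le M N \<longleftrightarrow> (\<forall>x. qform M x \<le> qform N x)"
  using qform_minus[of N M]
  by (auto simp: loewner_le_def pos_semidef_def assms transpose_minus qform_def[symmetric])

lemma invertible_ker: "invertible (M :: 'a::field^'n^'n) \<longleftrightarrow> (\<forall>x. M *v x = 0 \<longrightarrow> x = 0)"
  by (simp add: invertible_left_inverse matrix_left_invertible_ker)

lemma matrix_inv_left_right:
  assumes "invertible (M :: real^'n^'n)"
  shows "matrix_inv M ** M = mat 1" "M ** matrix_inv M = mat 1"
  using someI_ex[OF assms[unfolded invertible_def]] unfolding matrix_inv_def by auto

lemma matrix_inv_vector:
  assumes "invertible (M :: real^'n^'n)"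
  shows "matrix_inv M *v (M *v x) = x" "M *v (matrix_inv M *v x) = x"
  using matrix_inv_left_right[OF assms] by (simp_all add: matrix_vector_mul_assoc)

lemma matrix_inv_eqI:
  assumes "M ** N = mat 1"
  shows "matrix_inv (M :: real^'n^'n) = N"
  using assms invertible_right_inverse[of M] matrix_inv_left_right[of M]
  by (metis matrix_mul_assoc matrix_mul_lid matrix_mul_rid)

lemma pos_def_invertible: "pos_def M \<Longrightarrow> invertible M"
  unfolding invertible_ker by (metis inner_zero_right less_irrefl pos_def_def)

lemma symmetric_matrix_inv:
  assumes "invertible M" "transpose M = (M :: real^'n^'n)"
  shows "transpose (matrix_inv M) = matrix_inv M"
proof -
  have "transpose (matrix_inv M ** M) = mat 1"
    by (simp add: matrix_inv_left_right(1)[OF assms(1)])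
  then have "M ** transpose (matrix_inv M) = mat 1"
    by (simp add: matrix_transpose_mul assms(2))
  from matrix_inv_eqI[OF this] show ?thesis by simp
qed

lemma matrix_inv_matrix_inv: "invertible (M :: real^'n^'n) \<Longrightarrow> matrix_inv (matrix_inv M) = M"
  by (simp add: matrix_inv_eqI matrix_inv_left_right(1))

lemma qform_matrix_inv:
  assumes "invertible M" "transpose M = (M :: real^'n^'n)"
  shows "qform (matrix_inv M) (M *v y) = qform M y"
  by (simp add: qform_def matrix_inv_vector[OF assms(1)] inner_commute)

lemma pos_def_matrix_inv:
  assumes "pos_def M" shows "pos_def (matrix_inv M)"
  unfolding pos_def_iff
proof (intro conjI allI impI)
  note inv = pos_def_invertible[OF assms] and sym = pos_def_symmetric[OF assms]
  show "transpose (matrix_inv M) = matrix_inv M"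
    by (rule symmetric_matrix_inv[OF inv sym])
  fix x :: "real^'a" assume "x \<noteq> 0"
  then have "matrix_inv M *v x \<noteq> 0"
    using matrix_inv_vector(2)[OF inv, of x] by force
  then show "0 < qform (matrix_inv M) x"
    using qform_matrix_inv[OF inv sym, of "matrix_inv M *v x"] pos_def_pos[OF assms]
    by (simp add: matrix_inv_vector[OF inv])
qed

lemma symmetric_congruence_plus:
  assumes "transpose W = (W :: real^'n^'n)"
  shows "transpose ((E :: real^'n^'l) ** W ** transpose E + (N :: real^'m^'l) ** transpose N) = E ** W ** transpose E + N ** transpose N"
  by (simp add: transpose_plus matrix_transpose_mul assms matrix_mul_assoc)

text \<open>Young's inequality for the pair of dual norms given by \<open>W\<close> and \<open>W\<inverse>\<close>. All comparisons of
  inverses below come from it.\<close>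

lemma young_pos_def:
  assumes "pos_def W"
  shows "2 * (x \<bullet> y) \<le> qform (matrix_inv W) x + qform W y"
proof -
  note inv = pos_def_invertible[OF assms] and sym = pos_def_symmetric[OF assms]
  define u where "u = matrix_inv W *v x"
  have x: "x = W *v u"
    by (simp add: u_def matrix_inv_vector[OF inv])
  have "0 \<le> qform W (u - y)"
    by (rule pos_def_nonneg[OF assms])
  also have "\<dots> = qform (matrix_inv W) x + qform W y - 2 * (x \<bullet> y)"
    by (simp add: qform_diff_vector[OF sym] x qform_matrix_inv[OF inv sym] inner_symmetric_mult[OF sym])
  finally show ?thesis by simp
qed

lemma qform_matrix_inv_attains:
  assumes "pos_def W"
  shows "x \<bullet> (matrix_inv W *v x) = qform W (matrix_inv W *v x)"
  using assms by (simp add: qform_def matrix_inv_vector pos_def_invertible inner_commute)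

lemma qform_matrix_inv_antimono:
  assumes "pos_def M" "pos_def N" "\<And>x. qform M x \<le> qform N x"
  shows "qform (matrix_inv N) x \<le> qform (matrix_inv M) x"
  using young_pos_def[OF assms(1), of x "matrix_inv N *v x"] assms(3)[of "matrix_inv N *v x"]
    qform_matrix_inv_attains[OF assms(2), of x]
  by (simp add: qform_def)

lemma qform_matrix_inv_bound:
  assumes "pos_def W" "\<And>x. qform (matrix_inv W) x \<le> a * qform (matrix_inv V) x" "pos_def V" "0 < a"
  shows "qform V x \<le> a * qform W x"
proof -
  have inv: "invertible (matrix_inv W)" "invertible (matrix_inv V)"
    by (simp_all add: assms pos_def_invertible pos_def_matrix_inv)
  have *: "matrix_inv (a *\<^sub>R matrix_inv V) = (1 / a) *\<^sub>R V"
    using assms(4)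
    by (intro matrix_inv_eqI)
      (simp add: matrix_scalar_ac scalar_matrix_assoc[symmetric] matrix_inv_left_right
        pos_def_invertible[OF assms(3)])
  have "pos_def (a *\<^sub>R matrix_inv V)"
    using pos_def_matrix_inv[OF assms(3)] assms(4)
    by (simp add: pos_def_iff qform_scaleR_matrix transpose_scalar)
  from qform_matrix_inv_antimono[OF pos_def_matrix_inv[OF assms(1)] this, of x]
  have "(1 / a) * qform V x \<le> qform W x"
    by (simp add: assms(2) qform_scaleR_matrix * matrix_inv_matrix_inv pos_def_invertible assms(1))
  then show ?thesis
    using assms(4) by (simp add: field_simps)
qed

lemma pos_def_coercive:
  assumes "pos_def M"
  shows "\<exists>\<epsilon>>0. \<forall>x. \<epsilon> * (x \<bullet> x) \<le> qform M x"
proof -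
  obtain u where u: "u \<in> sphere (0::real^'a) 1" "\<And>x. x \<in> sphere 0 1 \<Longrightarrow> qform M u \<le> qform M x"
    using continuous_attains_inf[OF compact_sphere _ continuous_on_qform, of "0::real^'a" 1 M]
    by auto
  have "qform M u * (x \<bullet> x) \<le> qform M x" for x
  proof (cases "x = 0")
    case False
    then have "qform M u \<le> qform M ((1 / norm x) *\<^sub>R x)"
      by (intro u) simp
    also have "\<dots> = qform M x / (x \<bullet> x)"
      by (simp add: qform_scaleR power2_norm_eq_inner power_one_over)
    finally show ?thesis
      using False by (simp add: field_simps)
  qed simp
  moreover have "0 < qform M u"
    using u(1) by (intro pos_def_pos[OF assms]) auto
  ultimately show ?thesis by blast
qed

lemma qform_upper_bound: "\<exists>c>0. \<forall>x. qform M x \<le> c * (x \<bullet> x)"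
proof -
  obtain K where K: "K > 0" "\<And>x. norm (M *v x) \<le> norm x * K"
    using bounded_linear.pos_bounded[OF matrix_vector_mul_bounded_linear[of M]] by blast
  have "qform M x \<le> K * (x \<bullet> x)" for x
  proof -
    have "qform M x \<le> norm x * norm (M *v x)"
      unfolding qform_def by (rule norm_cauchy_schwarz)
    also have "\<dots> \<le> norm x * (norm x * K)"
      by (intro mult_left_mono K) simp
    finally show ?thesis
      by (simp add: power2_norm_eq_inner[symmetric] power2_eq_square mult.commute mult.left_commute)
  qed
  with K(1) show ?thesis by blast
qed

lemma qform_le_multiple_pos_def:
  assumes "pos_def N"
  shows "\<exists>c>0. \<forall>x. qform M x \<le> c * qform N x"
proof -
  obtain \<epsilon> where e: "\<epsilon> > 0" "\<And>x. \<epsilon> * (x \<bullet> x) \<le> qform N x"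
    using pos_def_coercive[OF assms] by blast
  obtain c where c: "c > 0" "\<And>x. qform M x \<le> c * (x \<bullet> x)"
    using qform_upper_bound by blast
  have "qform M x \<le> (c / \<epsilon>) * qform N x" for x
  proof -
    have "(c / \<epsilon>) * (\<epsilon> * (x \<bullet> x)) \<le> (c / \<epsilon>) * qform N x"
      by (rule mult_left_mono[OF e(2)]) (use c e in simp)
    then show ?thesis
      using c(2)[of x] e(1) by simp
  qed
  then show ?thesis
    using c(1) e(1) by (intro exI[of _ "c / \<epsilon>"]) simp
qed

text \<open>If \<open>E W E\<^sup>T \<le> \<lambda> I\<close>, then \<open>E\<^sup>T E \<le> \<lambda> W\<inverse>\<close>: both say that the norm of \<open>E W\<^sup>1\<^sup>/\<^sup>2\<close> is at most
  \<open>\<surd>\<lambda>\<close>.\<close>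

lemma gram_le_of_congruence_le:
  assumes "pos_def W" "\<And>u. qform W (transpose E *v u) \<le> l * (u \<bullet> u)" "0 \<le> l"
  shows "(E *v x) \<bullet> (E *v x) \<le> l * qform (matrix_inv W) x"
proof -
  define u where "u = E *v x"
  show ?thesis
  proof (cases "l = 0")
    case True
    have "qform W (transpose E *v u) = 0"
      using assms(2)[of u] pos_def_nonneg[OF assms(1), of "transpose E *v u"] True by simp
    then have "transpose E *v u = 0"
      using pos_def_pos[OF assms(1)] by fastforce
    then have "u \<bullet> u = 0"
      by (metis inner_mult_transpose inner_zero_left u_def)
    then show ?thesis using True by (simp add: u_def)
  next
    case False
    have "2 * (x \<bullet> (transpose E *v ((1 / l) *\<^sub>R u)))
        \<le> qform (matrix_inv W) x + qform W (transpose E *v ((1 / l) *\<^sub>R u))"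
      by (rule young_pos_def[OF assms(1)])
    also have "\<dots> \<le> qform (matrix_inv W) x + l * (((1 / l) *\<^sub>R u) \<bullet> ((1 / l) *\<^sub>R u))"
      by (intro add_left_mono assms(2))
    finally have "2 * (u \<bullet> u) / l \<le> qform (matrix_inv W) x + (u \<bullet> u) / l"
      using False by (simp add: inner_transpose_mult u_def)
    then show ?thesis
      using False assms(3) by (simp add: u_def field_simps)
  qed
qed

text \<open>Cramer's rule expresses the inverse through determinants, which are polynomials in the entries.\<close>

lemma tendsto_det:
  assumes "(M \<longlongrightarrow> (L :: real^'n^'n)) F"
  shows "((\<lambda>t. det (M t)) \<longlongrightarrow> det L) F"
  unfolding det_def by (auto intro!: tendsto_intros assms)

lemma matrix_inv_entry:
  assumes "invertible (M :: real^'n^'n)"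
  shows "matrix_inv M $ i $ j = det (\<chi> k l. if l = i then mat 1 $ k $ j else M $ k $ l) / det M"
proof -
  have "M *v column j (matrix_inv M) = column j (mat 1)"
    by (simp add: matrix_vector_mult_basis[symmetric] matrix_inv_vector[OF assms])
  then have "column j (matrix_inv M)
      = (\<chi> i. det (\<chi> k l. if l = i then column j (mat 1) $ k else M $ k $ l) / det M)"
    using cramer[of M] assms invertible_det_nz by blast
  then show ?thesis
    by (simp add: column_def vec_eq_iff cong: if_cong)
qed

lemma tendsto_matrix_inv:
  assumes "(M \<longlongrightarrow> (L :: real^'n^'n)) F" "invertible L" "\<And>t. invertible (M t)"
  shows "((\<lambda>t. matrix_inv (M t)) \<longlongrightarrow> matrix_inv L) F"
proof (rule tendsto_matrixI)
  fix i j
  have *: "((\<lambda>t. (\<chi> k l. if l = i then mat 1 $ k $ j else M t $ k $ l))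
     \<longlongrightarrow> ((\<chi> k l. if l = i then mat 1 $ k $ j else L $ k $ l) :: real^'n^'n)) F"
    by (rule tendsto_matrixI) (auto intro!: tendsto_intros assms)
  show "((\<lambda>t. matrix_inv (M t) $ i $ j) \<longlongrightarrow> matrix_inv L $ i $ j) F"
    unfolding matrix_inv_entry[OF assms(2)] matrix_inv_entry[OF assms(3)]
    by (intro tendsto_divide tendsto_det assms *) (use assms(2) invertible_det_nz in blast)
qed

section \<open>Reachability and observability\<close>

lemma matpow_Suc_right: "matpow (A :: 'a::semiring_1^'n^'n) (Suc k) = matpow A k ** A"
  by (induction k) (simp_all add: matrix_mul_assoc)

lemma transpose_matpow: "transpose (matpow (A :: real^'n^'n) k) = matpow (transpose A) k"
proof (induction k)
  case (Suc k)
  have "transpose (matpow A (Suc k)) = matpow (transpose A) k ** transpose A"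
    by (simp add: matrix_transpose_mul Suc)
  then show ?case by (simp only: matpow_Suc_right)
qed simp

lemma orthogonal_full_dim_zero:
  fixes S :: "(real^'n) set"
  assumes "dim S = CARD('n)" "\<And>s. s \<in> S \<Longrightarrow> s \<bullet> z = 0"
  shows "z = 0"
proof -
  have "span S = UNIV"
    using assms(1) dim_eq_full[of S] by simp
  moreover have "z \<in> span S \<Longrightarrow> orthogonal z z"
    using assms(2) by (intro orthogonal_to_span[of z S z]) (auto simp: orthogonal_def inner_commute)
  ultimately show ?thesis
    by (simp add: orthogonal_def)
qed

lemma reachable_ker_zero:
  fixes A :: "real^'n^'n" and B :: "real^'m^'n"
  assumes "is_reachable A B" "\<And>k. transpose B *v (matpow (transpose A) k *v z) = 0"
  shows "z = 0"
proof (rule orthogonal_full_dim_zero)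
  show "dim (\<Union>k<CARD('n). columns (matpow A k ** B)) = CARD('n)"
    using assms(1) by (simp add: is_reachable_def)
next
  fix s assume "s \<in> (\<Union>k<CARD('n). columns (matpow A k ** B))"
  then obtain k j where "s = (matpow A k ** B) *v axis j 1"
    by (auto simp: columns_def matrix_vector_mult_basis)
  then have "s \<bullet> z = axis j 1 \<bullet> (transpose B *v (matpow (transpose A) k *v z))"
    by (simp add: transpose_matpow[symmetric] inner_transpose_mult matrix_vector_mul_assoc[symmetric])
  then show "s \<bullet> z = 0"
    by (simp add: assms(2))
qed

text \<open>No nonzero set invariant under \<open>A\<^sup>T\<close> lies in the kernel of \<open>B\<^sup>T\<close>. In this form reachability
  makes the covariance matrices definite and excludes unstable left eigenvectors.\<close>

lemma reachable_invariant_zero: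
  assumes "is_reachable A B" "z \<in> S"
    and "\<And>z. z \<in> S \<Longrightarrow> transpose A *v z \<in> S" "\<And>z. z \<in> S \<Longrightarrow> transpose B *v z = 0"
  shows "z = 0"
proof -
  have "matpow (transpose A) k *v z \<in> S" for k
    by (induction k) (simp_all add: assms matrix_vector_mul_assoc[symmetric])
  with assms show ?thesis
    by (intro reachable_ker_zero[of A B]) auto
qed

lemma observable_ker_zero:
  fixes A :: "real^'n^'n" and C :: "real^'n^'p"
  assumes "is_observable C A" "\<And>k. k < CARD('n) \<Longrightarrow> C *v (matpow A k *v z) = 0"
  shows "z = 0"
proof (rule orthogonal_full_dim_zero)
  show "dim (\<Union>k<CARD('n). rows (C ** matpow A k)) = CARD('n)"
    using assms(1) by (simp add: is_observable_def)
next
  fix s assume "s \<in> (\<Union>k<CARD('n). rows (C ** matpow A k))"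
  then obtain k i where k: "k < CARD('n)" and s: "s = (C ** matpow A k) $ i"
    by (auto simp: rows_def row_def vec_lambda_eta)
  have "s \<bullet> z = (C *v (matpow A k *v z)) $ i"
    by (simp add: s matrix_vector_mul_assoc matrix_vector_mul_component)
  then show "s \<bullet> z = 0"
    by (simp add: assms(2)[OF k])
qed

section \<open>One step of the Riccati map\<close>

text \<open>The information matrix after the risk-sensitive measurement update.\<close>

definition stage_info :: "real \<Rightarrow> real^'n^'p \<Rightarrow> real^'n^'q \<Rightarrow> real^'n^'n \<Rightarrow> real^'n^'n" where
  "stage_info \<theta> C D P = matrix_inv P + transpose C ** C - \<theta> *\<^sub>R (transpose D ** D)"

lemma riccati_stage_info:
  "riccati \<theta> A B C D P = A ** matrix_inv (stage_info \<theta> C D P) ** transpose A + B ** transpose B"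
  by (simp add: riccati_def stage_info_def)

lemma qform_stage_info:
  "qform (stage_info \<theta> C D P) x
   = qform (matrix_inv P) x + (C *v x) \<bullet> (C *v x) - \<theta> * ((D *v x) \<bullet> (D *v x))"
  by (simp add: stage_info_def qform_plus qform_minus qform_scaleR_matrix qform_gram)

lemma qform_V_inv: "qform (V_inv \<theta> D P) x = qform (matrix_inv P) x - \<theta> * ((D *v x) \<bullet> (D *v x))"
  by (simp add: V_inv_def qform_minus qform_scaleR_matrix qform_gram)

lemma V_inv_symmetric:
  "pos_def P \<Longrightarrow> transpose (V_inv \<theta> D P) = V_inv \<theta> D P"
  by (simp add: V_inv_def transpose_minus transpose_scalar matrix_transpose_mul
      pos_def_symmetric pos_def_matrix_inv)

lemma stage_info_V_inv: "stage_info \<theta> C D P = V_inv \<theta> D P + transpose C ** C"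
  by (simp add: stage_info_def V_inv_def)

lemma pos_def_stage_info: "pos_def (V_inv \<theta> D P) \<Longrightarrow> pos_def (stage_info \<theta> C D P)"
  by (auto simp: stage_info_V_inv pos_def_iff transpose_plus matrix_transpose_mul qform_plus
      qform_gram intro: add_pos_nonneg)

lemma qform_riccati:
  "qform (riccati \<theta> A B C D P) z
   = qform (matrix_inv (stage_info \<theta> C D P)) (transpose A *v z)
     + (transpose B *v z) \<bullet> (transpose B *v z)"
  by (simp add: riccati_stage_info qform_plus qform_congruence qform_gram')

lemma riccati_symmetric:
  assumes "pos_def (V_inv \<theta> D P)"
  shows "transpose (riccati \<theta> A B C D P) = riccati \<theta> A B C D P"
  by (simp add: riccati_stage_info symmetric_congruence_plus pos_def_symmetric[OF pos_def_matrix_inv]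
      pos_def_stage_info assms)

lemma pos_def_riccati:
  assumes "is_reachable A B" "pos_def (V_inv \<theta> D P)"
  shows "pos_def (riccati \<theta> A B C D P)"
  unfolding pos_def_iff
proof (intro conjI allI impI riccati_symmetric[OF assms(2)])
  fix z :: "real^'a" assume "z \<noteq> 0"
  have pd: "pos_def (matrix_inv (stage_info \<theta> C D P))"
    by (intro pos_def_matrix_inv pos_def_stage_info assms)
  have "transpose A *v z \<noteq> 0 \<or> transpose B *v z \<noteq> 0"
  proof (rule ccontr)
    assume "\<not> ?thesis"
    then have "z = 0"
      by (intro reachable_invariant_zero[OF assms(1), of z "{z, 0}"]) auto
    with \<open>z \<noteq> 0\<close> show False ..
  qed
  then show "0 < qform (riccati \<theta> A B C D P) z"
    unfolding qform_riccati
    by (metis add_nonneg_pos add_pos_nonneg inner_ge_zero inner_gt_zero_iff pd pos_def_nonneg pos_def_pos)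
qed

lemma qform_V_inv_antimono:
  assumes "pos_def P" "pos_def Q" "\<And>x. qform P x \<le> qform Q x"
  shows "qform (V_inv \<theta> D Q) x \<le> qform (V_inv \<theta> D P) x"
  by (simp add: qform_V_inv qform_matrix_inv_antimono[OF assms])

lemma riccati_mono:
  assumes "pos_def P" "pos_def Q" "\<And>x. qform P x \<le> qform Q x"
    and "pos_def (V_inv \<theta> D P)" "pos_def (V_inv \<theta> D Q)"
  shows "qform (riccati \<theta> A B C D P) x \<le> qform (riccati \<theta> A B C D Q) x"
  unfolding qform_riccati
  by (intro add_right_mono qform_matrix_inv_antimono pos_def_stage_info assms)
    (simp add: qform_stage_info qform_matrix_inv_antimono[OF assms(1-3)])

text \<open>In information form, \<open>r(P)\<inverse>\<close> is the value function of a minimization: it charges a state \<open>z\<close>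
  the least \<open>x \<bullet> M x + \<bar>w\<bar>\<^sup>2\<close> over all predecessors \<open>x\<close> and noises \<open>w\<close> with \<open>A x + B w = z\<close>.
  The next two lemmas are the lower bound and its attainment.\<close>

lemma riccati_inv_le:
  assumes "is_reachable A B" "pos_def (V_inv \<theta> D P)"
  shows "qform (matrix_inv (riccati \<theta> A B C D P)) (A *v x + B *v w)
         \<le> qform (stage_info \<theta> C D P) x + w \<bullet> w"
proof -
  let ?R = "riccati \<theta> A B C D P" and ?M = "stage_info \<theta> C D P"
  have pdM: "pos_def ?M" and pdR: "pos_def ?R"
    by (simp_all add: pos_def_stage_info pos_def_riccati assms)
  define y where "y = matrix_inv ?R *v (A *v x + B *v w)"
  have "2 * ((A *v x + B *v w) \<bullet> y) = 2 * (x \<bullet> (transpose A *v y)) + 2 * (w \<bullet> (transpose B *v y))"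
    by (simp add: inner_transpose_mult inner_add_left)
  also have "\<dots> \<le> (qform ?M x + qform (matrix_inv ?M) (transpose A *v y))
      + (w \<bullet> w + (transpose B *v y) \<bullet> (transpose B *v y))"
  proof (rule add_mono)
    show "2 * (x \<bullet> (transpose A *v y)) \<le> qform ?M x + qform (matrix_inv ?M) (transpose A *v y)"
      using young_pos_def[OF pos_def_matrix_inv[OF pdM], of x "transpose A *v y"]
      by (simp add: matrix_inv_matrix_inv pos_def_invertible[OF pdM])
    show "2 * (w \<bullet> (transpose B *v y)) \<le> w \<bullet> w + (transpose B *v y) \<bullet> (transpose B *v y)"
      using inner_ge_zero[of "w - transpose B *v y"]
      by (simp add: inner_diff_left inner_diff_right inner_commute)
  qed
  also have "\<dots> = qform ?M x + w \<bullet> w + qform ?R y"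
    by (simp add: qform_riccati)
  also have "qform ?R y = (A *v x + B *v w) \<bullet> y"
    using qform_matrix_inv_attains[OF pdR] by (simp add: y_def)
  finally show ?thesis
    by (simp add: y_def qform_def)
qed

lemma riccati_inv_attained:
  assumes "is_reachable A B" "pos_def (V_inv \<theta> D P)"
  shows "\<exists>x w. A *v x + B *v w = z \<and>
           qform (matrix_inv (riccati \<theta> A B C D P)) z = qform (stage_info \<theta> C D P) x + w \<bullet> w"
proof -
  let ?R = "riccati \<theta> A B C D P" and ?M = "stage_info \<theta> C D P"
  have pdM: "pos_def ?M" and pdR: "pos_def ?R"
    by (simp_all add: pos_def_stage_info pos_def_riccati assms)
  define y where "y = matrix_inv ?R *v z"
  define x where "x = matrix_inv ?M *v (transpose A *v y)"
  define w where "w = transpose B *v y"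
  have "A *v x + B *v w = ?R *v y"
    by (simp add: x_def w_def riccati_stage_info matrix_vector_mult_add_rdistrib
        matrix_vector_mul_assoc[symmetric])
  also have "\<dots> = z"
    by (simp add: y_def matrix_inv_vector pos_def_invertible pdR)
  finally have "A *v x + B *v w = z" .
  moreover have "qform (matrix_inv ?R) z = qform ?R y"
    using qform_matrix_inv_attains[OF pdR, of z] by (simp add: qform_def y_def)
  moreover have "\<dots> = qform (matrix_inv ?M) (transpose A *v y) + w \<bullet> w"
    by (simp add: qform_riccati w_def)
  moreover have "qform (matrix_inv ?M) (transpose A *v y) = qform ?M x"
    using qform_matrix_inv_attains[OF pdM, of "transpose A *v y"] by (simp add: qform_def x_def)
  ultimately show ?thesis by metis
qed

section \<open>Contraction over a block of steps\<close>

primrec state :: "real^'n^'n \<Rightarrow> real^'m^'n \<Rightarrow> real^'n \<Rightarrow> (nat \<Rightarrow> real^'m) \<Rightarrow> nat \<Rightarrow> real^'n" where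
  "state A B x w 0 = x"
| "state A B x w (Suc k) = A *v state A B x w k + B *v w k"

definition stage_cost :: "real \<Rightarrow> real^'n^'p \<Rightarrow> real^'n^'q \<Rightarrow> real^'n \<Rightarrow> real^'m \<Rightarrow> real" where
  "stage_cost \<theta> C D x w = w \<bullet> w + (C *v x) \<bullet> (C *v x) - \<theta> * ((D *v x) \<bullet> (D *v x))"

definition block_cost :: "real \<Rightarrow> real^'n^'n \<Rightarrow> real^'m^'n \<Rightarrow> real^'n^'p \<Rightarrow> real^'n^'q
    \<Rightarrow> real^'n \<Rightarrow> (nat \<Rightarrow> real^'m) \<Rightarrow> nat \<Rightarrow> real" where
  "block_cost \<theta> A B C D x w k = (\<Sum>j<k. stage_cost \<theta> C D (state A B x w j) (w j))"

definition admissible_orbit :: "real \<Rightarrow> real^'n^'n \<Rightarrow> real^'m^'n \<Rightarrow> real^'n^'p \<Rightarrow> real^'n^'q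
    \<Rightarrow> (nat \<Rightarrow> real^'n^'n) \<Rightarrow> bool" where
  "admissible_orbit \<theta> A B C D p \<longleftrightarrow>
     (\<forall>t. pos_def (p t) \<and> pos_def (V_inv \<theta> D (p t)) \<and> p (Suc t) = riccati \<theta> A B C D (p t))"

lemma state_cong: "(\<And>j. j < k \<Longrightarrow> w j = w' j) \<Longrightarrow> state A B x w k = state A B x w' k"
  by (induction k) auto

lemma block_cost_cong:
  assumes "\<And>j. j < k \<Longrightarrow> w j = w' j"
  shows "block_cost \<theta> A B C D x w k = block_cost \<theta> A B C D x w' k"
  unfolding block_cost_def
proof (rule sum.cong[OF refl])
  fix j assume j: "j \<in> {..<k}"
  have "state A B x w j = state A B x w' j"
    by (rule state_cong) (use assms j in auto)
  then show "stage_cost \<theta> C D (state A B x w j) (w j) = stage_cost \<theta> C D (state A B x w' j) (w' j)"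
    using assms j by simp
qed

lemma stage_cost_stage_info:
  "qform (stage_info \<theta> C D P) x + w \<bullet> w = qform (matrix_inv P) x + stage_cost \<theta> C D x w"
  by (simp add: qform_stage_info stage_cost_def)

lemma orbit_inv_le:
  assumes "is_reachable A B" "admissible_orbit \<theta> A B C D p"
  shows "qform (matrix_inv (p (t + k))) (state A B x w k)
         \<le> qform (matrix_inv (p t)) x + block_cost \<theta> A B C D x w k"
proof (induction k)
  case 0
  show ?case by (simp add: block_cost_def)
next
  case (Suc k)
  have "qform (matrix_inv (p (t + Suc k))) (state A B x w (Suc k))
      \<le> qform (matrix_inv (p (t + k))) (state A B x w k) + stage_cost \<theta> C D (state A B x w k) (w k)"
    using riccati_inv_le[OF assms(1), of \<theta> D "p (t + k)" C "state A B x w k" "w k"] assms(2)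
    by (simp add: stage_cost_stage_info admissible_orbit_def)
  with Suc show ?case
    by (simp add: block_cost_def)
qed

lemma orbit_inv_attained:
  assumes "is_reachable A B" "admissible_orbit \<theta> A B C D p"
  shows "\<exists>x w. state A B x w k = z \<and>
     qform (matrix_inv (p (t + k))) z = qform (matrix_inv (p t)) x + block_cost \<theta> A B C D x w k"
proof (induction k arbitrary: z)
  case 0
  show ?case by (simp add: block_cost_def)
next
  case (Suc k)
  obtain y v where yv: "A *v y + B *v v = z"
    "qform (matrix_inv (p (t + Suc k))) z = qform (matrix_inv (p (t + k))) y + stage_cost \<theta> C D y v"
    using riccati_inv_attained[OF assms(1), of \<theta> D "p (t + k)" z C] assms(2)
    by (auto simp: stage_cost_stage_info admissible_orbit_def)
  obtain x w where xw: "state A B x w k = y"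
    "qform (matrix_inv (p (t + k))) y = qform (matrix_inv (p t)) x + block_cost \<theta> A B C D x w k"
    using Suc by blast
  define w' where "w' = w(k := v)"
  have s: "state A B x w' k = y" and c: "block_cost \<theta> A B C D x w' k = block_cost \<theta> A B C D x w k"
    using xw(1) state_cong[of k w' w A B x] block_cost_cong[of k w' w \<theta> A B C D x] by (auto simp: w'_def)
  have "block_cost \<theta> A B C D x w' (Suc k) = block_cost \<theta> A B C D x w k + stage_cost \<theta> C D y v"
    using c s by (simp add: block_cost_def w'_def)
  then have "qform (matrix_inv (p (t + Suc k))) z
      = qform (matrix_inv (p t)) x + block_cost \<theta> A B C D x w' (Suc k)"
    using yv(2) xw(2) by simp
  moreover have "state A B x w' (Suc k) = z"
    using s yv(1) by (simp add: w'_def)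
  ultimately show ?case by blast
qed

text \<open>Follow a trajectory that is optimal for the fixed point \<open>P\<close>. Replacing the initial charge
  \<open>P\<inverse>\<close> by \<open>p\<^sub>t\<inverse> \<le> a P\<inverse>\<close> raises the total by at most \<open>a - 1\<close> times the initial charge, and this is
  a fixed fraction \<open>\<kappa> < 1\<close> of the total because the block cost dominates a multiple of it.\<close>

lemma block_contraction:
  fixes P :: "real^'n^'n"
  assumes reach: "is_reachable A B" and P: "pos_def P" "pos_def (V_inv \<theta> D P)" "riccati \<theta> A B C D P = P"
    and \<epsilon>: "0 < \<epsilon>" "\<And>x w. \<epsilon> * (x \<bullet> x) \<le> block_cost \<theta> A B C D x w N"
  shows "\<exists>\<kappa>. 0 \<le> \<kappa> \<and> \<kappa> < 1 \<and> (\<forall>p t a. admissible_orbit \<theta> A B C D p \<longrightarrow> 1 \<le> a \<longrightarrow>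
     (\<forall>x. qform (matrix_inv (p t)) x \<le> a * qform (matrix_inv P) x) \<longrightarrow>
     (\<forall>x. qform (matrix_inv (p (t + N))) x \<le> (1 + \<kappa> * (a - 1)) * qform (matrix_inv P) x))"
proof -
  obtain c where c: "0 < c" "\<And>x. qform (matrix_inv P) x \<le> c * (x \<bullet> x)"
    using qform_upper_bound by blast
  define \<kappa> where "\<kappa> = 1 / (1 + \<epsilon> / c)"
  have \<kappa>: "0 \<le> \<kappa>" "\<kappa> < 1"
    using \<epsilon>(1) c(1) by (simp_all add: \<kappa>_def field_simps)
  have const: "admissible_orbit \<theta> A B C D (\<lambda>_. P)"
    using P by (simp add: admissible_orbit_def)
  have "qform (matrix_inv (p (t + N))) z \<le> (1 + \<kappa> * (a - 1)) * qform (matrix_inv P) z"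
    if p: "admissible_orbit \<theta> A B C D p" and a: "1 \<le> a"
      and le: "\<And>x. qform (matrix_inv (p t)) x \<le> a * qform (matrix_inv P) x" for p t a z
  proof -
    obtain x w where xw: "state A B x w N = z"
      "qform (matrix_inv P) z = qform (matrix_inv P) x + block_cost \<theta> A B C D x w N"
      using orbit_inv_attained[OF reach const, of N z] by blast
    have "\<epsilon> / c * qform (matrix_inv P) x \<le> \<epsilon> / c * (c * (x \<bullet> x))"
      by (rule mult_left_mono[OF c(2)]) (use c \<epsilon> in simp)
    also have "\<dots> = \<epsilon> * (x \<bullet> x)"
      using c(1) by simp
    also have "\<dots> \<le> block_cost \<theta> A B C D x w N"
      by (rule \<epsilon>(2))
    finally have "(1 + \<epsilon> / c) * qform (matrix_inv P) x \<le> qform (matrix_inv P) z"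
      using xw(2) by (simp add: algebra_simps)
    then have init: "qform (matrix_inv P) x \<le> \<kappa> * qform (matrix_inv P) z"
      using \<epsilon>(1) c(1) by (simp add: \<kappa>_def pos_le_divide_eq add_pos_pos mult.commute)
    have "qform (matrix_inv (p (t + N))) z \<le> qform (matrix_inv (p t)) x + block_cost \<theta> A B C D x w N"
      using orbit_inv_le[OF reach p, of t N x w] xw(1) by simp
    also have "\<dots> \<le> qform (matrix_inv P) z + (a - 1) * qform (matrix_inv P) x"
      using le[of x] xw(2) by (simp add: algebra_simps)
    also have "\<dots> \<le> qform (matrix_inv P) z + (a - 1) * (\<kappa> * qform (matrix_inv P) z)"
      by (intro add_left_mono mult_left_mono init) (use a in simp)
    finally show ?thesis
      by (simp add: algebra_simps)
  qed
  with \<kappa> show ?thesis by blast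
qed

text \<open>Iterate the contraction along each residue class of times modulo \<open>N\<close>, starting all of them from a
  common bound for the first \<open>N\<close> iterates.\<close>

lemma orbit_inv_eventually_le:
  fixes P :: "real^'n^'n"
  assumes reach: "is_reachable A B" and P: "pos_def P" "pos_def (V_inv \<theta> D P)" "riccati \<theta> A B C D P = P"
    and \<epsilon>: "0 < \<epsilon>" "\<And>x w. \<epsilon> * (x \<bullet> x) \<le> block_cost \<theta> A B C D x w N"
    and p: "admissible_orbit \<theta> A B C D p" and N: "0 < N"
  shows "\<exists>b. b \<longlonglongrightarrow> (1::real) \<and> (\<forall>t. 1 \<le> b t \<and>
           (\<forall>x. qform (matrix_inv (p t)) x \<le> b t * qform (matrix_inv P) x))"
proof -
  obtain \<kappa> where \<kappa>: "0 \<le> \<kappa>" "\<kappa> < 1" and contr: "\<And>t a x. 1 \<le> a \<Longrightarrow>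
     (\<And>x. qform (matrix_inv (p t)) x \<le> a * qform (matrix_inv P) x) \<Longrightarrow>
     qform (matrix_inv (p (t + N))) x \<le> (1 + \<kappa> * (a - 1)) * qform (matrix_inv P) x"
    using block_contraction[OF reach P \<epsilon>] p by metis
  have pdP: "pos_def (matrix_inv P)"
    by (rule pos_def_matrix_inv[OF P(1)])
  have "\<exists>c>0. \<forall>x. qform (matrix_inv (p s)) x \<le> c * qform (matrix_inv P) x" for s
    by (rule qform_le_multiple_pos_def[OF pdP])
  then obtain c where c: "\<And>s. c s > 0" "\<And>s x. qform (matrix_inv (p s)) x \<le> c s * qform (matrix_inv P) x"
    by metis
  define a where "a = 1 + (\<Sum>s<N. c s)"
  have a1: "1 \<le> a"
    by (simp add: a_def sum_nonneg c(1) less_imp_le)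
  have start: "qform (matrix_inv (p s)) x \<le> a * qform (matrix_inv P) x" if "s < N" for s x
  proof -
    have "c s \<le> (\<Sum>s<N. c s)"
      using that by (intro member_le_sum) (auto simp: c(1) less_imp_le)
    then have "c s * qform (matrix_inv P) x \<le> a * qform (matrix_inv P) x"
      by (intro mult_right_mono pos_def_nonneg[OF pdP]) (simp add: a_def)
    then show ?thesis
      using c(2)[of s x] by linarith
  qed
  have step: "qform (matrix_inv (p (s + j * N))) x \<le> (1 + \<kappa> ^ j * (a - 1)) * qform (matrix_inv P) x"
    if "s < N" for s j x
  proof (induction j arbitrary: x)
    case 0
    show ?case using start[OF that] by simp
  next
    case (Suc j)
    have "1 \<le> 1 + \<kappa> ^ j * (a - 1)"
      using a1 \<kappa>(1) by simp
    from contr[OF this Suc, of x] show ?case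
      by (simp add: ac_simps)
  qed
  define b where "b t = 1 + \<kappa> ^ (t div N) * (a - 1)" for t
  have "filterlim (\<lambda>t. t div N) at_top sequentially"
  proof (unfold filterlim_at_top, intro allI)
    show "\<forall>\<^sub>F t in sequentially. Z \<le> t div N" for Z
      using N by (intro eventually_sequentiallyI[of "Z * N"]) (simp add: less_eq_div_iff_mult_less_eq)
  qed
  then have "(\<lambda>t. \<kappa> ^ (t div N)) \<longlonglongrightarrow> 0"
    using LIMSEQ_realpow_zero[OF \<kappa>] by (rule filterlim_compose[rotated])
  then have "b \<longlonglongrightarrow> 1 + 0 * (a - 1)"
    unfolding b_def by (intro tendsto_intros)
  moreover have "qform (matrix_inv (p t)) x \<le> b t * qform (matrix_inv P) x" for t x
    using step[of "t mod N" "t div N" x] N by (simp add: b_def)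
  moreover have "1 \<le> b t" for t
    using a1 \<kappa>(1) by (simp add: b_def)
  ultimately show ?thesis by auto
qed

text \<open>A constant orbit \<open>Q\<close> inherits the limit 1 of its bounds, so \<open>Q\<inverse> \<le> P\<inverse>\<close>, and the roles of
  \<open>P\<close> and \<open>Q\<close> can be exchanged.\<close>

lemma riccati_fixed_point_unique:
  fixes P Q :: "real^'n^'n"
  assumes reach: "is_reachable A B"
    and \<epsilon>: "0 < \<epsilon>" "\<And>x w. \<epsilon> * (x \<bullet> x) \<le> block_cost \<theta> A B C D x w N" "0 < N"
    and P: "pos_def P" "pos_def (V_inv \<theta> D P)" "riccati \<theta> A B C D P = P"
    and Q: "pos_def Q" "pos_def (V_inv \<theta> D Q)" "riccati \<theta> A B C D Q = Q"
  shows "Q = P"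
proof -
  have le: "qform (matrix_inv Q) x \<le> qform (matrix_inv P) x"
    if P: "pos_def P" "pos_def (V_inv \<theta> D P)" "riccati \<theta> A B C D P = P"
      and Q: "pos_def Q" "pos_def (V_inv \<theta> D Q)" "riccati \<theta> A B C D Q = Q" for P Q :: "real^'n^'n" and x
  proof -
    have "admissible_orbit \<theta> A B C D (\<lambda>_. Q)"
      using Q by (simp add: admissible_orbit_def)
    then obtain b where b: "b \<longlonglongrightarrow> 1" "\<And>t. qform (matrix_inv Q) x \<le> b t * qform (matrix_inv P) x"
      using orbit_inv_eventually_le[OF reach P \<epsilon>(1,2) _ \<epsilon>(3)] by blast
    have "(\<lambda>t. b t * qform (matrix_inv P) x) \<longlonglongrightarrow> 1 * qform (matrix_inv P) x"
      by (intro tendsto_intros b)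
    then show ?thesis
      using b(2) LIMSEQ_le_const by fastforce
  qed
  have "matrix_inv Q = matrix_inv P"
  proof (rule symmetric_eqI)
    show "qform (matrix_inv Q) x = qform (matrix_inv P) x" for x
      using le[OF P Q, of x] le[OF Q P, of x] by (rule antisym)
  qed (simp_all add: pos_def_symmetric[OF pos_def_matrix_inv] P(1) Q(1))
  then have "matrix_inv (matrix_inv Q) = matrix_inv (matrix_inv P)"
    by (rule arg_cong)
  then show ?thesis
    by (simp add: matrix_inv_matrix_inv pos_def_invertible P(1) Q(1))
qed

section \<open>Schur stability and powers\<close>

lemma norm_vector_scalar_mult: "norm (c *s (v :: complex^'n)) = cmod c * norm v"
  by (simp add: norm_vec_def norm_mult L2_set_right_distrib)

lemma vector_scalar_mult_of_real: "complex_of_real r *s (v :: complex^'n) = r *\<^sub>R v"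
  by (simp add: vec_eq_iff scaleR_conv_of_real[where 'a = complex])

lemma matrix_vector_mult_scalar: "M *v (c *s v) = c *s (M *v (v :: 'a::comm_semiring_1^'n))"
  by (simp add: matrix_vector_mult_def vec_eq_iff sum_distrib_left mult.left_commute)

lemma mat_vector_mult: "mat c *v v = c *s (v :: 'a::comm_semiring_1^'n)"
  by (simp add: matrix_vector_mult_def mat_def vec_eq_iff if_distrib if_distribR sum.delta cong: if_cong)

text \<open>Horner's rule for \<open>p(M) v\<close>.\<close>

definition poly_apply :: "complex^'n^'n \<Rightarrow> complex poly \<Rightarrow> complex^'n \<Rightarrow> complex^'n" where
  "poly_apply M p v = fold_coeffs (\<lambda>a w. a *s v + M *v w) p 0"

lemma poly_apply_0 [simp]: "poly_apply M 0 v = 0"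
  by (simp add: poly_apply_def)

lemma poly_apply_pCons [simp]: "poly_apply M (pCons a p) v = a *s v + M *v poly_apply M p v"
  by (cases "p = 0 \<and> a = 0") (auto simp: poly_apply_def)

lemma poly_apply_plus: "poly_apply M (p + q) v = poly_apply M p v + poly_apply M q v"
  by (induction p q rule: poly_induct2)
    (simp_all add: matrix_vector_right_distrib vector_sadd_rdistrib algebra_simps)

lemma poly_apply_smult: "poly_apply M (smult c p) v = c *s poly_apply M p v"
  by (induction p) (simp_all add: matrix_vector_mult_scalar vector_add_ldistrib vector_smult_assoc)

lemma poly_apply_sum: "poly_apply M (\<Sum>i\<in>I. f i) v = (\<Sum>i\<in>I. poly_apply M (f i) v)"
  by (induction I rule: infinite_finite_induct) (simp_all add: poly_apply_plus)

lemma poly_apply_monom: "poly_apply M (monom c k) v = c *s (matpow M k *v v)"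
  by (induction k)
    (simp_all add: monom_0 monom_Suc matrix_vector_mult_scalar matrix_vector_mul_assoc)

lemma poly_apply_shift: "poly_apply M p (M *v v - c *s v) = M *v poly_apply M p v - c *s poly_apply M p v"
proof (induction p)
  case (pCons a p)
  have "poly_apply M (pCons a p) (M *v v - c *s v)
      = a *s (M *v v - c *s v) + M *v (M *v poly_apply M p v - c *s poly_apply M p v)"
    using pCons.IH by simp
  also have "\<dots> = M *v poly_apply M (pCons a p) v - c *s poly_apply M (pCons a p) v"
    by (simp add: matrix_vector_right_distrib matrix_vector_mult_diff_distrib
        matrix_vector_mult_scalar vec_eq_iff algebra_simps)
  finally show ?case .
qed simp

lemma poly_apply_linear_factor:
  "poly_apply M ([:- c, 1:] * q) v = M *v poly_apply M q v - c *s poly_apply M q v"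
proof -
  have "[:- c, 1:] * q = smult (- c) q + pCons 0 q"
    by simp
  then show ?thesis
    unfolding \<open>[:- c, 1:] * q = smult (- c) q + pCons 0 q\<close> poly_apply_plus poly_apply_smult
    by (simp add: vec_eq_iff)
qed

lemma linear_relation_exists:
  fixes f :: "nat \<Rightarrow> 'a::euclidean_space"
  shows "\<exists>u. (\<exists>i\<le>DIM('a). u i \<noteq> 0) \<and> (\<Sum>i\<le>DIM('a). u i *\<^sub>R f i) = 0"
proof (cases "inj_on f {..DIM('a)}")
  case True
  then have "dependent (f ` {..DIM('a)})"
    by (intro dependent_biggerset) (simp_all add: card_image)
  then obtain u where "\<exists>v\<in>f ` {..DIM('a)}. u v \<noteq> 0" "(\<Sum>v\<in>f ` {..DIM('a)}. u v *\<^sub>R v) = 0"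
    by (auto simp: dependent_finite)
  then show ?thesis
    by (intro exI[of _ "\<lambda>i. u (f i)"]) (auto simp: sum.reindex[OF True])
next
  case False
  then obtain i j where ij: "i \<le> DIM('a)" "j \<le> DIM('a)" "i \<noteq> j" "f i = f j"
    by (auto simp: inj_on_def)
  define u :: "nat \<Rightarrow> real" where "u k = (if k = i then 1 else 0) - (if k = j then 1 else 0)" for k
  have "(\<Sum>k\<le>DIM('a). u k *\<^sub>R f k) = f i - f j"
    using ij by (simp add: u_def scaleR_diff_left sum_subtractf if_distrib[of "\<lambda>r. r *\<^sub>R _"]
        sum.delta cong: if_cong)
  with ij show ?thesis
    by (intro exI[of _ u]) (auto simp: u_def)
qed

lemma annihilating_poly_exists: "\<exists>p. p \<noteq> 0 \<and> poly_apply M p v = 0"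
proof -
  let ?d = "DIM(complex^'a)"
  obtain u where u: "\<exists>i\<le>?d. u i \<noteq> 0" "(\<Sum>i\<le>?d. u i *\<^sub>R (matpow M i *v v)) = 0"
    using linear_relation_exists[of "\<lambda>i. matpow M i *v v"] by blast
  define p where "p = (\<Sum>i\<le>?d. monom (complex_of_real (u i)) i)"
  obtain i where i: "i \<le> ?d" "u i \<noteq> 0"
    using u(1) by blast
  have "coeff p i = (\<Sum>k\<le>?d. if k = i then complex_of_real (u k) else 0)"
    by (simp add: p_def coeff_sum)
  also have "\<dots> = complex_of_real (u i)"
    using i(1) by (simp add: sum.delta)
  finally have "coeff p i = complex_of_real (u i)" .
  then have "p \<noteq> 0"
    using i(2) by auto
  moreover have "poly_apply M p v = 0"
    using u(2) by (simp add: p_def poly_apply_sum poly_apply_monom vector_scalar_mult_of_real)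
  ultimately show ?thesis by blast
qed

lemma recurrence_tendsto_0:
  fixes y e :: "nat \<Rightarrow> complex^'n"
  assumes "\<And>k. y (Suc k) = c *s y k + e k" "cmod c < 1" "e \<longlonglongrightarrow> 0"
  shows "y \<longlonglongrightarrow> 0"
proof (rule LIMSEQ_I)
  fix r :: real assume r: "0 < r"
  define s where "s = r / 2"
  have "0 < (1 - cmod c) * s"
    using r assms(2) by (simp add: s_def)
  with assms(3) obtain K where K: "\<And>k. K \<le> k \<Longrightarrow> norm (e k) < (1 - cmod c) * s"
    by (auto simp: LIMSEQ_iff)
  have *: "norm (y (K + j)) - s \<le> cmod c ^ j * norm (y K)" for j
  proof (induction j)
    case 0
    show ?case using r by (simp add: s_def)
  next
    case (Suc j)
    have "norm (y (K + Suc j)) \<le> cmod c * norm (y (K + j)) + norm (e (K + j))"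
      using norm_triangle_ineq[of "c *s y (K + j)" "e (K + j)"]
      by (simp add: assms(1) norm_vector_scalar_mult)
    also have "\<dots> \<le> cmod c * (s + cmod c ^ j * norm (y K)) + (1 - cmod c) * s"
      using Suc K[of "K + j"] by (intro add_mono mult_left_mono) auto
    finally show ?case
      by (simp add: algebra_simps)
  qed
  have "(\<lambda>j. cmod c ^ j * norm (y K)) \<longlonglongrightarrow> 0 * norm (y K)"
    by (intro tendsto_intros LIMSEQ_realpow_zero) (use assms(2) in auto)
  then obtain J where J: "\<And>j. J \<le> j \<Longrightarrow> cmod c ^ j * norm (y K) < s"
    using r order_tendstoD(2)[of _ 0 sequentially s] by (auto simp: s_def eventually_sequentially)
  have "norm (y k - 0) < r" if "K + J \<le> k" for k
  proof -
    have "J \<le> k - K"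
      using that by linarith
    then show ?thesis
      using *[of "k - K"] J[of "k - K"] that by (simp add: s_def)
  qed
  then show "\<exists>N. \<forall>k\<ge>N. norm (y k - 0) < r" by blast
qed

text \<open>Split an annihilating polynomial of \<open>v\<close> into linear factors. A root that is no eigenvalue can be
  cancelled; a root \<open>c\<close> that is one has modulus below 1, and \<open>M\<^sup>k v\<close> then solves a recurrence with
  multiplier \<open>c\<close> and a forcing term \<open>M\<^sup>k (M v - c v)\<close> that tends to 0 by induction on the degree.\<close>

lemma matpow_tendsto_0_if_annihilated:
  fixes M :: "complex^'n^'n"
  assumes "\<And>c. c \<in> eigenvalues M \<Longrightarrow> cmod c < 1" "p \<noteq> 0" "poly_apply M p v = 0"
  shows "(\<lambda>k. matpow M k *v v) \<longlonglongrightarrow> 0"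
  using assms(2,3)
proof (induction "degree p" arbitrary: p v rule: less_induct)
  case less
  show ?case
  proof (cases "degree p = 0")
    case True
    then obtain a where "p = [:a:]"
      using degree_eq_zeroE by blast
    with less.prems have "v = 0"
      by simp
    then show ?thesis by simp
  next
    case False
    then obtain c where "poly p c = 0"
      using fundamental_theorem_of_algebra[of p] constant_degree[of p] by auto
    then obtain q where p: "p = [:- c, 1:] * q"
      using poly_eq_0_iff_dvd by (metis dvdE)
    with less.prems have q: "q \<noteq> 0" by auto
    have deg: "degree q < degree p"
      using q unfolding p by (subst degree_mult_eq) auto
    have eig: "M *v poly_apply M q v = c *s poly_apply M q v"
      using less.prems(2) unfolding p poly_apply_linear_factor by simp
    show ?thesis
    proof (cases "c \<in> eigenvalues M")
      case False
      then have "poly_apply M q v = 0"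
        using eig by (auto simp: eigenvalues_def)
      then show ?thesis
        by (rule less.hyps[OF deg q])
    next
      case True
      have "poly_apply M q (M *v v - c *s v) = 0"
        by (simp add: poly_apply_shift eig)
      then have forcing: "(\<lambda>k. matpow M k *v (M *v v - c *s v)) \<longlonglongrightarrow> 0"
        by (rule less.hyps[OF deg q])
      have recurrence: "matpow M (Suc k) *v v = c *s (matpow M k *v v) + matpow M k *v (M *v v - c *s v)" for k
        by (subst matpow_Suc_right)
          (simp add: matrix_vector_mul_assoc[symmetric] matrix_vector_mult_diff_distrib
            matrix_vector_mult_scalar)
      show ?thesis
        by (rule recurrence_tendsto_0[OF recurrence assms(1)[OF True] forcing])
    qed
  qed
qed

definition complex_vec :: "real^'n \<Rightarrow> complex^'n" where
  "complex_vec x = (\<chi> i. complex_of_real (x $ i))"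

lemma complex_vec_mult: "map_matrix complex_of_real M *v complex_vec x = complex_vec (M *v x)"
  by (simp add: complex_vec_def matrix_vector_mult_def vec_eq_iff)

lemma complex_vec_matpow:
  "matpow (map_matrix complex_of_real M) k *v complex_vec x = complex_vec (matpow M k *v x)"
  by (induction k) (simp_all add: complex_vec_mult matrix_vector_mul_assoc[symmetric])

lemma schur_stable_matpow_vector_tendsto_0:
  assumes "schur_stable (M :: real^'n^'n)"
  shows "(\<lambda>k. matpow M k *v x) \<longlonglongrightarrow> 0"
proof (rule vec_tendstoI)
  fix i
  let ?M = "map_matrix complex_of_real M"
  obtain p where "p \<noteq> 0" "poly_apply ?M p (complex_vec x) = 0"
    using annihilating_poly_exists by blast
  then have "(\<lambda>k. matpow ?M k *v complex_vec x) \<longlonglongrightarrow> 0"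
    using assms by (intro matpow_tendsto_0_if_annihilated)
      (auto simp: schur_stable_def complex_eigenvalues_def)
  then have "(\<lambda>k. Re (complex_vec (matpow M k *v x) $ i)) \<longlonglongrightarrow> Re (0 $ i)"
    unfolding complex_vec_matpow by (intro tendsto_Re tendsto_vec_nth)
  then show "(\<lambda>k. (matpow M k *v x) $ i) \<longlonglongrightarrow> 0 $ i"
    by (simp add: complex_vec_def)
qed

lemma schur_stable_matpow_tendsto_0:
  assumes "schur_stable (M :: real^'n^'n)"
  shows "matpow M \<longlonglongrightarrow> 0"
proof (rule tendsto_matrixI)
  fix i j
  have "(\<lambda>k. (matpow M k *v axis j 1) $ i) \<longlonglongrightarrow> 0 $ i"
    by (intro tendsto_vec_nth schur_stable_matpow_vector_tendsto_0 assms)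
  then show "(\<lambda>k. matpow M k $ i $ j) \<longlonglongrightarrow> 0 $ i $ j"
    by (simp add: matrix_vector_mult_basis column_def)
qed

section \<open>Spectra\<close>

text \<open>The characteristic polynomial is not zero, as no eigenvalue exceeds the operator norm; so it has
  finitely many roots.\<close>

lemma finite_complex_eigenvalues: "finite (complex_eigenvalues M)"
proof -
  define N where "N = map_matrix complex_of_real M"
  define p where "p = det (\<chi> i j. [:N $ i $ j:] - (if i = j then [:0, 1:] else 0))"
  have poly_p: "poly p c = det (N - mat c)" for c
    unfolding p_def det_def
    by (auto simp: poly_sum poly_prod mat_def intro!: sum.cong prod.cong)
  have root: "poly p c = 0" if "c \<in> eigenvalues N" for c
  proof -
    from that obtain v where v: "v \<noteq> 0" "N *v v = c *s v"
      by (auto simp: eigenvalues_def)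
    have "(N - mat c) *v v = 0"
      using v(2) by (simp add: matrix_vector_mult_diff_rdistrib mat_vector_mult)
    then have "\<not> invertible (N - mat c)"
      using v(1) by (auto simp: invertible_ker)
    then show ?thesis
      by (simp add: poly_p invertible_det_nz)
  qed
  obtain K where K: "K > 0" "\<And>v. norm (N *v v) \<le> norm v * K"
    using bounded_linear.pos_bounded[OF matrix_vector_mul_bounded_linear[of N]] by blast
  have "det (N - mat (complex_of_real (K + 1))) \<noteq> 0"
    unfolding invertible_det_nz[symmetric] invertible_ker
  proof (intro allI impI)
    fix v assume "(N - mat (complex_of_real (K + 1))) *v v = 0"
    then have "N *v v = complex_of_real (K + 1) *s v"
      by (simp add: matrix_vector_mult_diff_rdistrib mat_vector_mult)
    then have "(K + 1) * norm v \<le> norm v * K"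
      using K(2)[of v] K(1) norm_vector_scalar_mult[of "complex_of_real (K + 1)" v] by (simp add: norm_of_real[symmetric] del: norm_of_real)
    then show "v = 0"
      by (simp add: algebra_simps)
  qed
  then have "p \<noteq> 0"
    unfolding poly_p[symmetric] by auto
  then have "finite {c. poly p c = 0}"
    by (rule poly_roots_finite)
  then show ?thesis
    by (rule finite_subset[rotated]) (auto simp: complex_eigenvalues_def N_def[symmetric] root)
qed

lemma finite_real_eigenvalues: "finite (eigenvalues (M :: real^'n^'n))"
proof -
  have "complex_of_real c \<in> complex_eigenvalues M" if c: "c \<in> eigenvalues M" for c
  proof -
    from c obtain v where v: "v \<noteq> 0" "M *v v = c *s v"
      by (auto simp: eigenvalues_def)
    have "complex_vec v \<noteq> 0"
      using v(1) by (auto simp: complex_vec_def vec_eq_iff)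
    moreover have "map_matrix complex_of_real M *v complex_vec v = complex_of_real c *s complex_vec v"
      by (simp add: complex_vec_mult v(2)) (simp add: complex_vec_def vec_eq_iff)
    ultimately show ?thesis
      by (auto simp: complex_eigenvalues_def eigenvalues_def)
  qed
  then have "finite (complex_of_real ` eigenvalues M)"
    by (intro finite_subset[OF _ finite_complex_eigenvalues[of M]]) auto
  then show ?thesis
    by (rule finite_imageD) (auto simp: inj_on_def)
qed

lemma cmod_le_spec_radius: "c \<in> complex_eigenvalues M \<Longrightarrow> cmod c \<le> spec_radius M"
  by (simp add: spec_radius_def finite_complex_eigenvalues)

text \<open>If the form were nonzero in the direction \<open>N u\<close>, a small step from \<open>u\<close> against it would make
  the form negative.\<close>

lemma psd_null_vector:
  assumes "transpose N = (N :: real^'n^'n)" "\<And>x. 0 \<le> qform N x" "qform N u = 0"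
  shows "N *v u = 0"
proof -
  define y where "y = N *v u"
  define a where "a = y \<bullet> y"
  define b where "b = qform N y"
  have b: "0 \<le> b"
    by (simp add: b_def assms(2))
  \<comment> \<open>The minimizer of \<open>t\<^sup>2 (b + 1) + 2 t a\<close>; adding 1 to \<open>b\<close> avoids a division by zero.\<close>
  define t where "t = - a / (b + 1)"
  have "u \<bullet> (N *v y) = a"
    by (simp add: a_def y_def inner_symmetric_mult[OF assms(1)])
  then have "qform N (u + t *\<^sub>R y) = t\<^sup>2 * b + 2 * t * a"
    using assms(3) by (simp add: qform_add_vector[OF assms(1)] qform_scaleR b_def
        matrix_vector_mult_scaleR)
  then have "0 \<le> t\<^sup>2 * b + 2 * t * a"
    using assms(2)[of "u + t *\<^sub>R y"] by simp
  then have "0 \<le> (b + 1)\<^sup>2 * (t\<^sup>2 * b + 2 * t * a)"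
    by simp
  also have "\<dots> = (t * (b + 1))\<^sup>2 * b + 2 * (t * (b + 1)) * (b + 1) * a"
    by (simp add: power2_eq_square algebra_simps)
  also have "t * (b + 1) = - a"
    using b by (simp add: t_def)
  finally have "a\<^sup>2 * (b + 2) \<le> 0"
    by (simp add: power2_eq_square algebra_simps)
  then have "a = 0"
    using b by (smt (verit) mult_pos_pos zero_less_power2)
  then show ?thesis
    by (simp add: a_def y_def)
qed

text \<open>A maximizer of the form on the unit sphere is a null vector of the semidefinite matrix
  \<open>m I - M\<close>, so the maximum \<open>m\<close> is an eigenvalue.\<close>

lemma qform_le_lambda_max:
  assumes "transpose M = (M :: real^'n^'n)"
  shows "qform M x \<le> lambda_max M * (x \<bullet> x)"
proof -
  obtain u where u: "u \<in> sphere (0::real^'n) 1" "\<And>x. x \<in> sphere 0 1 \<Longrightarrow> qform M x \<le> qform M u"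
    using continuous_attains_sup[OF compact_sphere _ continuous_on_qform, of "0::real^'n" 1 M]
    by auto
  define m where "m = qform M u"
  have uu: "u \<bullet> u = 1"
    using u(1) by (simp add: norm_eq_1)
  have le: "qform M x \<le> m * (x \<bullet> x)" for x
  proof (cases "x = 0")
    case False
    then have "qform M ((1 / norm x) *\<^sub>R x) \<le> m"
      unfolding m_def by (intro u) simp
    moreover have "qform M ((1 / norm x) *\<^sub>R x) = qform M x / (x \<bullet> x)"
      by (simp add: qform_scaleR power2_norm_eq_inner power_one_over)
    ultimately show ?thesis
      using False by (simp add: field_simps)
  qed simp
  have "(m *\<^sub>R mat 1 - M) *v u = 0"
    using le uu by (intro psd_null_vector)
      (simp_all add: transpose_minus transpose_scalar assms qform_minus qform_scaleR_matrix m_def)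
  then have "M *v u = m *s u"
    by (simp add: matrix_vector_mult_diff_rdistrib scaleR_matrix_vector_assoc[symmetric] scalar_mult_eq_scaleR)
  moreover have "u \<noteq> 0"
    using uu by auto
  ultimately have "m \<in> eigenvalues M"
    by (auto simp: eigenvalues_def)
  then have "m \<le> lambda_max M"
    by (simp add: lambda_max_def finite_real_eigenvalues)
  then show ?thesis
    using le[of x] mult_right_mono[of m "lambda_max M" "x \<bullet> x"] by simp
qed

section \<open>The Lyapunov equation\<close>

lemma matrix_mult_add_left: "(M + N) ** (L :: real^'n^'m) = M ** L + N ** L"
  by (simp add: matrix_matrix_mult_def vec_eq_iff sum.distrib distrib_right)

lemma matrix_mult_zero [simp]: "(0 :: real^'n^'m) ** L = 0" "(K :: real^'n^'m) ** 0 = 0"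
  by (simp_all add: matrix_matrix_mult_def vec_eq_iff)

text \<open>Iterating the equation gives \<open>S = F\<^sup>k S (F\<^sup>k)\<^sup>T\<close> for all \<open>k\<close>, and the right-hand side tends to 0.\<close>

lemma stein_homogeneous:
  assumes "schur_stable F" "S = F ** S ** transpose F"
  shows "S = 0"
proof -
  have pow: "S = matpow F k ** S ** transpose (matpow F k)" for k
  proof (induction k)
    case (Suc k)
    have "matpow F (Suc k) ** S ** transpose (matpow F (Suc k))
        = F ** (matpow F k ** S ** transpose (matpow F k)) ** transpose F"
      by (simp add: matrix_transpose_mul matrix_mul_assoc)
    then show ?case
      using Suc assms(2) by simp
  qed simp
  have "(\<lambda>k. matpow F k ** S ** transpose (matpow F k)) \<longlonglongrightarrow> 0 ** S ** transpose 0"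
    by (intro tendsto_matrix_mult tendsto_transpose schur_stable_matpow_tendsto_0 tendsto_const assms(1))
  then have "(\<lambda>k::nat. S) \<longlonglongrightarrow> 0"
    using pow by simp
  then show ?thesis
    using LIMSEQ_unique tendsto_const by blast
qed

text \<open>The Stein operator is injective by the previous lemma, hence bijective.\<close>

lemma stein_unique_solution:
  assumes "schur_stable (F :: real^'n^'n)"
  shows "\<exists>!S. S = F ** S ** transpose F + Q"
proof -
  define T where "T S = S - F ** S ** transpose F" for S
  have "linear T"
    unfolding T_def
    by (intro linearI)
      (simp_all add: matrix_add_ldistrib matrix_mult_add_left scaleR_diff_right
        matrix_scalar_ac scalar_matrix_assoc)
  moreover have "inj T"
    unfolding linear_injective_0[OF \<open>linear T\<close>]
    using stein_homogeneous[OF assms] by (simp add: T_def)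
  ultimately have "bij T"
    using linear_injective_imp_surjective by (auto simp: bij_def)
  then have "\<exists>!S. T S = Q"
    by (simp add: bij_iff)
  moreover have "T S = Q \<longleftrightarrow> S = F ** S ** transpose F + Q" for S
    by (auto simp: T_def algebra_simps)
  ultimately show ?thesis by simp
qed

lemma stein_symmetric:
  assumes "schur_stable F" "transpose Q = Q" "S = F ** S ** transpose F + Q"
  shows "transpose S = S"
proof -
  have "transpose S = F ** transpose S ** transpose F + Q"
    using arg_cong[OF assms(3), of transpose]
    by (simp add: transpose_plus matrix_transpose_mul assms(2) matrix_mul_assoc)
  with assms(3) stein_unique_solution[OF assms(1), of Q] show ?thesis by blast
qed

text \<open>The form of \<open>S\<close> does not increase under \<open>F\<^sup>T\<close>, and its values along \<open>(F\<^sup>k)\<^sup>T z\<close> tend to 0.\<close>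

lemma stein_nonneg:
  assumes "schur_stable F" "\<And>z. 0 \<le> qform Q z" "S = F ** S ** transpose F + Q"
  shows "0 \<le> qform S z"
proof -
  have step: "qform S (transpose F *v z) \<le> qform S z" for z
    using arg_cong[OF assms(3), of "\<lambda>S. qform S z"] assms(2)[of z]
    by (simp add: qform_plus qform_congruence)
  have "qform S (transpose (matpow F k) *v z) \<le> qform S z" for k
  proof (induction k)
    case (Suc k)
    have "transpose (matpow F (Suc k)) *v z = transpose F *v (transpose (matpow F k) *v z)"
      by (simp add: matpow_Suc_right matrix_transpose_mul matrix_vector_mul_assoc del: matpow.simps)
    then show ?case
      using step[of "transpose (matpow F k) *v z"] Suc by simp
  qed simp
  moreover have "(\<lambda>k. qform S (transpose (matpow F k) *v z)) \<longlonglongrightarrow> qform S (transpose 0 *v z)"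
    by (intro tendsto_qform tendsto_const tendsto_matrix_vector_mult tendsto_transpose
        schur_stable_matpow_tendsto_0 assms(1))
  ultimately show ?thesis
    using LIMSEQ_le_const2 by fastforce
qed

section \<open>The block quadratic form\<close>

lemma pos_strict_mono:
  assumes "i < (j :: 'k::{finite,linorder})" shows "pos i < pos j"
proof -
  have "j \<in> {x. x \<le> j} - {x. x \<le> i}" "{x. x \<le> i} \<subseteq> {x. x \<le> j}"
    using assms by auto
  then have "{x. x \<le> i} \<subset> {x. x \<le> j}"
    by blast
  then show ?thesis
    unfolding pos_def by (intro psubset_card_mono) auto
qed

lemma pos_ge_1: "1 \<le> pos i"
  unfolding pos_def using card_gt_0_iff[of "{j. j \<le> i}"] by fastforce

lemma pos_le_card: "pos (i :: 'k::{finite,linorder}) \<le> CARD('k)"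
  unfolding pos_def by (rule card_mono) auto

text \<open>Block index \<open>i\<close> stands for time \<open>N - pos i\<close>: the stacked vectors list the latest time first.\<close>

lemma bij_block_time:
  "bij_betw (\<lambda>i :: 'k::{finite,linorder}. CARD('k) - pos i) UNIV {..<CARD('k)}"
proof -
  have "inj (\<lambda>i :: 'k. CARD('k) - pos i)"
  proof (rule injI)
    fix i j :: 'k assume "CARD('k) - pos i = CARD('k) - pos j"
    then have "pos i = pos j"
      using pos_le_card[of i] pos_le_card[of j] by linarith
    then show "i = j"
      using pos_strict_mono[of i j] pos_strict_mono[of j i] by (metis less_irrefl linorder_neqE)
  qed
  moreover have "range (\<lambda>i :: 'k. CARD('k) - pos i) \<subseteq> {..<CARD('k)}"
  proof clarsimp
    fix i :: 'k
    show "CARD('k) - pos i < CARD('k)"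
      using pos_ge_1[of i] by (intro diff_less) auto
  qed
  ultimately show ?thesis
    unfolding bij_betw_def
    by (intro conjI card_subset_eq) (simp_all add: card_image)
qed

lemma sum_block_time: "(\<Sum>i\<in>UNIV. g (CARD('k) - pos (i :: 'k::{finite,linorder}))) = (\<Sum>k<CARD('k). g k)"
  using sum.reindex_bij_betw[OF bij_block_time] .

definition stack :: "(nat \<Rightarrow> real^'m) \<Rightarrow> real^('k::{finite,linorder} \<times> 'm)" where
  "stack f = (\<chi> s. f (CARD('k) - pos (fst s)) $ snd s)"

lemma sum_prod_UNIV: "(\<Sum>s\<in>UNIV. g (fst s) (snd s)) = (\<Sum>i\<in>UNIV. \<Sum>a\<in>UNIV. g i a)"
  by (simp add: sum.cartesian_product case_prod_beta)

lemma inner_stack: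
  fixes f :: "nat \<Rightarrow> real^'m"
  shows "(stack f :: real^('k::{finite,linorder} \<times> 'm)) \<bullet> stack f = (\<Sum>k<CARD('k). f k \<bullet> f k)"
proof -
  have "(stack f :: real^('k \<times> 'm)) \<bullet> stack f
      = (\<Sum>i\<in>UNIV. \<Sum>a\<in>UNIV. f (CARD('k) - pos (i :: 'k)) $ a * f (CARD('k) - pos i) $ a)"
    unfolding inner_vec_def stack_def by (simp add: sum_prod_UNIV[symmetric])
  also have "\<dots> = (\<Sum>i\<in>UNIV. f (CARD('k) - pos (i :: 'k)) \<bullet> f (CARD('k) - pos i))"
    by (simp add: inner_vec_def)
  also have "\<dots> = (\<Sum>k<CARD('k). f k \<bullet> f k)"
    by (rule sum_block_time)
  finally show ?thesis .
qed

lemma matrix_vector_mult_sum: "M *v (\<Sum>i\<in>I. f i) = (\<Sum>i\<in>I. (M :: real^'n^'m) *v f i)"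
  by (induction I rule: infinite_finite_induct) (simp_all add: matrix_vector_right_distrib)

lemma state_explicit:
  "state A B x w k = matpow A k *v x + (\<Sum>l<k. matpow A (k - 1 - l) *v (B *v w l))"
proof (induction k)
  case (Suc k)
  have "(\<Sum>l<k. A *v (matpow A (k - 1 - l) *v (B *v w l))) = (\<Sum>l<k. matpow A (k - l) *v (B *v w l))"
  proof (rule sum.cong[OF refl])
    fix l assume "l \<in> {..<k}"
    then have *: "k - l = Suc (k - 1 - l)" by auto
    then show "A *v (matpow A (k - 1 - l) *v (B *v w l)) = matpow A (k - l) *v (B *v w l)"
      by (simp only: * matpow.simps matrix_vector_mul_assoc[symmetric])
  qed
  then show ?case
    by (simp add: Suc matrix_vector_right_distrib matrix_vector_mult_sum matrix_vector_mul_assoc[symmetric])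
qed simp

text \<open>The block matrices map an initial state and a stacked noise to the stacked outputs of the state
  recursion: the Toeplitz entries vanish on noise that acts at or after the time of the output.\<close>

lemma stack_output:
  fixes A :: "real^'n^'n" and B :: "real^'m^'n" and E :: "real^'n^'p"
  shows "(obs_block E A :: real^'n^('k::{finite,linorder} \<times> 'p)) *v x
         + (toeplitz_block E A B :: real^('k \<times> 'm)^('k \<times> 'p)) *v stack w
       = stack (\<lambda>k. E *v state A B x w k)"
proof (rule vec_eq_iff[THEN iffD2], rule allI)
  fix r :: "'k \<times> 'p"
  define k where "k = CARD('k) - pos (fst r)"
  have k: "k \<le> CARD('k)"
    by (simp add: k_def)
  define g where "g l = (markov E A B (int k - int l) *v w l) $ snd r" for l
  have "((toeplitz_block E A B :: real^('k \<times> 'm)^('k \<times> 'p)) *v stack w) $ r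
      = (\<Sum>j\<in>UNIV. \<Sum>b\<in>UNIV. markov E A B (int (pos (j :: 'k)) - int (pos (fst r))) $ snd r $ b
           * w (CARD('k) - pos j) $ b)"
    unfolding matrix_vector_mult_def toeplitz_block_def stack_def by (simp add: sum_prod_UNIV[symmetric])
  also have "\<dots> = (\<Sum>j\<in>UNIV. g (CARD('k) - pos (j :: 'k)))"
  proof (rule sum.cong[OF refl])
    fix j :: 'k
    have "int (pos j) - int (pos (fst r)) = int k - int (CARD('k) - pos j)"
      using pos_le_card[of j] pos_le_card[of "fst r"] by (simp add: k_def of_nat_diff)
    then show "(\<Sum>b\<in>UNIV. markov E A B (int (pos j) - int (pos (fst r))) $ snd r $ b
        * w (CARD('k) - pos j) $ b) = g (CARD('k) - pos j)"
      by (simp add: g_def matrix_vector_mult_def)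
  qed
  also have "\<dots> = (\<Sum>l<CARD('k). g l)"
    by (rule sum_block_time)
  also have "\<dots> = (\<Sum>l<k. g l)"
    using k by (intro sum.mono_neutral_right) (auto simp: g_def markov_def)
  also have "\<dots> = (\<Sum>l<k. (E *v (matpow A (k - 1 - l) *v (B *v w l))) $ snd r)"
  proof (rule sum.cong[OF refl])
    fix l assume "l \<in> {..<k}"
    then have "int k - int l \<ge> 1" "nat (int k - int l - 1) = k - 1 - l"
      by auto
    then show "g l = (E *v (matpow A (k - 1 - l) *v (B *v w l))) $ snd r"
      by (simp add: g_def markov_def matrix_vector_mul_assoc matrix_mul_assoc)
  qed
  finally have toep: "((toeplitz_block E A B :: real^('k \<times> 'm)^('k \<times> 'p)) *v stack w) $ r
      = (\<Sum>l<k. (E *v (matpow A (k - 1 - l) *v (B *v w l))) $ snd r)" .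
  have obs: "((obs_block E A :: real^'n^('k \<times> 'p)) *v x) $ r = (E *v (matpow A k *v x)) $ snd r"
    by (simp add: matrix_vector_mul_component obs_block_def k_def matrix_vector_mul_assoc)
  have "(stack (\<lambda>k. E *v state A B x w k) :: real^('k \<times> 'p)) $ r = (E *v state A B x w k) $ snd r"
    by (simp add: stack_def k_def)
  then show "((obs_block E A :: real^'n^('k \<times> 'p)) *v x
         + (toeplitz_block E A B :: real^('k \<times> 'm)^('k \<times> 'p)) *v stack w) $ r
       = stack (\<lambda>k. E *v state A B x w k) $ r"
    by (simp add: toep obs state_explicit matrix_vector_right_distrib
        matrix_vector_mult_sum)
qed

lemma block_cost_stack:
  fixes A :: "real^'n^'n" and B :: "real^'m^'n" and C :: "real^'n^'p" and D :: "real^'n^'q"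
    and x :: "real^'n" and w :: "nat \<Rightarrow> real^'m"
  defines "y \<equiv> obs_block C A *v x + (toeplitz_block C A B :: real^('k \<times> 'm)^('k::{finite,linorder} \<times> 'p)) *v stack w"
    and "z \<equiv> obs_block D A *v x + (toeplitz_block D A B :: real^('k \<times> 'm)^('k \<times> 'q)) *v stack w"
  shows "block_cost \<theta> A B C D x w CARD('k)
       = (stack w :: real^('k \<times> 'm)) \<bullet> stack w + y \<bullet> y - \<theta> * (z \<bullet> z)"
  unfolding y_def z_def stack_output inner_stack block_cost_def stage_cost_def
  by (simp add: sum.distrib sum_subtractf sum_distrib_left)

lemma pos_def_one_plus_gram: "pos_def (mat 1 + transpose H ** (H :: real^'m^'p))"
  by (auto simp: pos_def_iff transpose_plus matrix_transpose_mul qform_plus qform_gram intro: add_pos_nonneg)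

lemma pos_def_one_plus_gram': "pos_def (mat 1 + H ** transpose (H :: real^'m^'p))"
  using pos_def_one_plus_gram[of "transpose H"] by simp

text \<open>Completing the square. The first two terms are minimal over the noise \<open>W\<close> at
  \<open>W = - H\<^sup>T K O x\<close>, with minimum \<open>x \<bullet> \<Omega> x\<close>, and there the regulated output is \<open>J x\<close>. In terms
  of the deviation \<open>v\<close> from this noise it is \<open>J x + L v\<close>, and what \<open>- \<theta> \<bar>J x + L v\<bar>\<^sup>2\<close> can
  take away is bounded by the dual form of \<open>T = I - \<theta> L (I + H\<^sup>T H)\<inverse> L\<^sup>T\<close>.\<close>

lemma block_form_lower_bound:
  fixes H :: "real^'m^'p" and L :: "real^'m^'q" and Ob :: "real^'n^'p" and ObR :: "real^'n^'q"
    and \<theta> :: real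
  defines "K \<equiv> matrix_inv (mat 1 + H ** transpose H)"
    and "M \<equiv> mat 1 + transpose H ** H"
  defines "LL \<equiv> L ** matrix_inv M ** transpose L"
    and "J \<equiv> ObR - L ** transpose H ** K ** Ob"
  defines "T \<equiv> mat 1 - \<theta> *\<^sub>R LL"
  assumes \<theta>: "0 \<le> \<theta>" and T: "pos_def T"
  shows "qform (transpose Ob ** K ** Ob) x - \<theta> * qform (matrix_inv T) (J *v x)
    \<le> W \<bullet> W + (Ob *v x + H *v W) \<bullet> (Ob *v x + H *v W)
      - \<theta> * ((ObR *v x + L *v W) \<bullet> (ObR *v x + L *v W))"
proof -
  have pdM: "pos_def M" and pdI: "pos_def (mat 1 + H ** transpose H)"
    by (simp_all add: M_def pos_def_one_plus_gram pos_def_one_plus_gram')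
  note symM = pos_def_symmetric[OF pdM]
  define y where "y = Ob *v x"
  define k where "k = K *v y"
  have y: "y = k + H *v (transpose H *v k)"
    using matrix_inv_vector(2)[OF pos_def_invertible[OF pdI], of y]
    by (simp add: k_def K_def matrix_vector_mult_add_rdistrib matrix_vector_mul_assoc[symmetric])
  have Omega: "qform (transpose Ob ** K ** Ob) x = k \<bullet> y"
    by (simp add: qform_def inner_transpose_mult matrix_vector_mul_assoc[symmetric] y_def k_def inner_commute)
  define v where "v = W + transpose H *v k"
  have W: "W = v - transpose H *v k"
    by (simp add: v_def)
  have "W \<bullet> W + (y + H *v W) \<bullet> (y + H *v W) = k \<bullet> y + qform M v"
  proof -
    have "y + H *v W = k + H *v v"
      by (subst y) (simp add: W matrix_vector_mult_diff_distrib)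
    moreover have "W \<bullet> W = v \<bullet> v - 2 * (k \<bullet> (H *v v)) + k \<bullet> (H *v (transpose H *v k))"
      by (simp add: W inner_diff_left inner_diff_right inner_mult_transpose inner_transpose_mult
          matrix_vector_mult_diff_distrib inner_commute)
    moreover have "k \<bullet> y = k \<bullet> k + k \<bullet> (H *v (transpose H *v k))"
      by (subst y) (simp add: inner_add_right)
    moreover have "qform M v = v \<bullet> v + (H *v v) \<bullet> (H *v v)"
      by (simp add: M_def qform_plus qform_gram)
    ultimately show ?thesis
      by (simp add: inner_add_left inner_add_right inner_commute)
  qed
  moreover have "\<theta> * ((ObR *v x + L *v W) \<bullet> (ObR *v x + L *v W))
      \<le> qform M v + \<theta> * qform (matrix_inv T) (J *v x)"
  proof (cases "\<theta> = 0")
    case True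
    then show ?thesis using pos_def_nonneg[OF pdM] by simp
  next
    case False
    define g where "g = J *v x"
    have out: "ObR *v x + L *v W = g + L *v v"
      by (simp add: g_def J_def W matrix_vector_mult_diff_rdistrib matrix_vector_mult_diff_distrib
          matrix_vector_mul_assoc[symmetric] k_def y_def)
    define h where "h = matrix_inv T *v g"
    define e where "e = matrix_inv M *v (transpose L *v h)"
    have Me: "M *v e = transpose L *v h"
      by (simp add: e_def matrix_inv_vector pos_def_invertible[OF pdM])
    have "g = T *v h"
      by (simp add: h_def matrix_inv_vector pos_def_invertible[OF T])
    then have g: "g = h - \<theta> *\<^sub>R (L *v e)"
      by (simp add: T_def LL_def e_def matrix_vector_mult_diff_rdistrib
          scaleR_matrix_vector_assoc[symmetric] matrix_vector_mul_assoc[symmetric])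
    define u where "u = v - \<theta> *\<^sub>R e"
    have "g + L *v v = h + L *v u"
      by (simp add: g u_def matrix_vector_mult_diff_distrib matrix_vector_mult_scaleR)
    then have "\<theta> * ((g + L *v v) \<bullet> (g + L *v v))
        = \<theta> * (h \<bullet> h) + 2 * \<theta> * (h \<bullet> (L *v u)) + \<theta> * ((L *v u) \<bullet> (L *v u))"
      by (simp add: inner_add_left inner_add_right inner_commute algebra_simps)
    moreover have "\<theta> * ((L *v u) \<bullet> (L *v u)) \<le> qform M u"
    proof -
      have "qform (matrix_inv M) (transpose L *v a) \<le> 1 / \<theta> * (a \<bullet> a)" for a
        using pos_def_nonneg[OF T, of a] False \<theta>
        by (simp add: T_def LL_def qform_minus qform_scaleR_matrix qform_congruence field_simps)
      from gram_le_of_congruence_le[OF pos_def_matrix_inv[OF pdM] this, of u]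
      show ?thesis
        using False \<theta> by (simp add: matrix_inv_matrix_inv pos_def_invertible[OF pdM] field_simps)
    qed
    moreover have "qform M v = qform M u + 2 * \<theta> * (h \<bullet> (L *v u)) + \<theta>\<^sup>2 * (h \<bullet> (L *v e))"
    proof -
      have "v = u + \<theta> *\<^sub>R e" by (simp add: u_def)
      then have "qform M v = qform M u + \<theta>\<^sup>2 * qform M e + 2 * \<theta> * (u \<bullet> (M *v e))"
        by (simp add: qform_add_vector[OF symM] qform_scaleR matrix_vector_mult_scaleR)
      then show ?thesis
        by (simp add: qform_def Me inner_transpose_mult inner_commute)
    qed
    moreover have "qform (matrix_inv T) g = h \<bullet> h - \<theta> * (h \<bullet> (L *v e))"
      by (simp add: qform_def h_def[symmetric]) (simp add: g inner_diff_left inner_diff_right inner_commute)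
    then have "\<theta> * qform (matrix_inv T) g = \<theta> * (h \<bullet> h) - \<theta>\<^sup>2 * (h \<bullet> (L *v e))"
      by (simp add: power2_eq_square right_diff_distrib)
    ultimately show ?thesis
      unfolding out g_def[symmetric] by linarith
  qed
  ultimately show ?thesis
    unfolding Omega y_def[symmetric] by linarith
qed

section \<open>Positivity of the block form below the threshold\<close>

lemma LL_N_symmetric:
  "transpose (LL_N A B C D) = (LL_N A B C D :: real^('k \<times> 'q)^('k::{finite,linorder} \<times> 'q))"
  for D :: "real^'n^'q"
  by (simp add: LL_N_def Let_def matrix_transpose_mul matrix_mul_assoc
      pos_def_symmetric[OF pos_def_matrix_inv[OF pos_def_one_plus_gram]])

lemma pos_def_below_theta_N:
  fixes D :: "real^'n^'q"
  assumes "0 \<le> s" "ereal s < theta_N TYPE('k::{finite,linorder}) A B C D"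
  shows "pos_def (mat 1 - s *\<^sub>R (LL_N A B C D :: real^('k \<times> 'q)^('k \<times> 'q)))"
proof -
  let ?LL = "LL_N A B C D :: real^('k \<times> 'q)^('k \<times> 'q)"
  have "s * qform ?LL u < u \<bullet> u" if "u \<noteq> 0" for u
  proof (cases "s = 0 \<or> toeplitz_block D A B = (0 :: real^('k \<times> _)^('k \<times> 'q))")
    case True
    then have "s * qform ?LL u = 0"
      by (auto simp: LL_N_def)
    with that show ?thesis by (metis inner_gt_zero_iff)
  next
    case False
    then have s: "0 < s" "s < 1 / lambda_max ?LL"
      using assms by (auto simp: theta_N_def)
    then have "0 < lambda_max ?LL"
      by (meson less_trans zero_less_divide_1_iff)
    then have "s * lambda_max ?LL < 1"
      using s(2) by (simp add: field_simps)
    have "s * qform ?LL u \<le> s * (lambda_max ?LL * (u \<bullet> u))"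
      using s(1) by (intro mult_left_mono qform_le_lambda_max LL_N_symmetric) simp
    also have "\<dots> = (s * lambda_max ?LL) * (u \<bullet> u)"
      by simp
    also have "\<dots> < 1 * (u \<bullet> u)"
      using \<open>s * lambda_max ?LL < 1\<close> that by (intro mult_strict_right_mono) simp_all
    finally show ?thesis by simp
  qed
  then show ?thesis
    by (simp add: pos_def_iff qform_minus qform_scaleR_matrix transpose_minus transpose_scalar
        LL_N_symmetric)
qed

text \<open>Unlike the defining formula with \<open>(S\<^sub>N\<^sup>\<theta>)\<inverse>\<close>, this form needs no case distinction at \<open>\<theta> = 0\<close>
  and shows continuity there.\<close>

lemma Omega_theta_eq:
  fixes D :: "real^'n^'q"
  assumes "0 \<le> s" "pos_def (mat 1 - s *\<^sub>R (LL_N A B C D :: real^('k \<times> 'q)^('k::{finite,linorder} \<times> 'q)))"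
  shows "Omega_theta TYPE('k) s A B C D = Omega_N TYPE('k) A B C
    - s *\<^sub>R (transpose (J_N A B C D) ** matrix_inv (mat 1 - s *\<^sub>R (LL_N A B C D :: real^('k \<times> 'q)^('k \<times> 'q)))
        ** J_N A B C D)"
proof (cases "s = 0")
  case False
  let ?T = "mat 1 - s *\<^sub>R (LL_N A B C D :: real^('k \<times> 'q)^('k \<times> 'q))"
  have S: "(S_N s A B C D :: real^('k \<times> 'q)^('k \<times> 'q)) = (- (1 / s)) *\<^sub>R ?T"
    using False by (simp add: S_N_def scaleR_diff_right)
  have "matrix_inv (S_N s A B C D :: real^('k \<times> 'q)^('k \<times> 'q)) = (- s) *\<^sub>R matrix_inv ?T"
    unfolding S using False
    by (intro matrix_inv_eqI) (simp add: matrix_scalar_ac scalar_matrix_assoc[symmetric]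
        matrix_inv_left_right pos_def_invertible[OF assms(2)] del: scaleR_minus_left)
  then show ?thesis
    using False by (simp add: Omega_theta_def Let_def matrix_scalar_ac scalar_matrix_assoc[symmetric]
        del: scaleR_minus_left) simp
qed (simp add: Omega_theta_def)

lemma Omega_N_symmetric: "transpose (Omega_N TYPE('k::{finite,linorder}) A B C) = Omega_N TYPE('k) A B C"
  by (simp add: Omega_N_def Let_def matrix_transpose_mul matrix_mul_assoc
      pos_def_symmetric[OF pos_def_matrix_inv[OF pos_def_one_plus_gram']])

lemma Omega_theta_symmetric:
  fixes D :: "real^'n^'q"
  assumes "0 \<le> s" "ereal s < theta_N TYPE('k::{finite,linorder}) A B C D"
  shows "transpose (Omega_theta TYPE('k) s A B C D) = Omega_theta TYPE('k) s A B C D"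
  using pos_def_below_theta_N[OF assms]
  by (simp add: Omega_theta_eq assms(1) transpose_minus transpose_scalar matrix_transpose_mul
      matrix_mul_assoc Omega_N_symmetric pos_def_symmetric[OF pos_def_matrix_inv])

lemma continuous_on_Omega_theta:
  fixes D :: "real^'n^'q"
  assumes "ereal a < theta_N TYPE('k::{finite,linorder}) A B C D"
  shows "continuous_on {0..a} (\<lambda>s. Omega_theta TYPE('k) s A B C D)"
  unfolding continuous_on_sequentially comp_def
proof (intro allI ballI impI, elim conjE)
  fix x :: "nat \<Rightarrow> real" and s
  assume s: "s \<in> {0..a}" and x: "\<forall>n. x n \<in> {0..a}" and lim: "x \<longlonglongrightarrow> s"
  have pd: "pos_def (mat 1 - r *\<^sub>R (LL_N A B C D :: real^('k \<times> 'q)^('k \<times> 'q)))" if "r \<in> {0..a}" for r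
  proof (rule pos_def_below_theta_N)
    show "ereal r < theta_N TYPE('k) A B C D"
      using that assms by (auto intro: le_less_trans[of _ "ereal a"])
  qed (use that in auto)
  have eq: "Omega_theta TYPE('k) r A B C D = Omega_N TYPE('k) A B C
    - r *\<^sub>R (transpose (J_N A B C D) ** matrix_inv (mat 1 - r *\<^sub>R (LL_N A B C D :: real^('k \<times> 'q)^('k \<times> 'q)))
        ** J_N A B C D)" if "r \<in> {0..a}" for r
    using that by (intro Omega_theta_eq pd) auto
  have xa: "x n \<in> {0..a}" for n using x by blast
  show "(\<lambda>n. Omega_theta TYPE('k) (x n) A B C D) \<longlonglongrightarrow> Omega_theta TYPE('k) s A B C D"
    unfolding eq[OF s] eq[OF xa]
    by (intro tendsto_intros tendsto_matrix_mult tendsto_matrix_inv lim pos_def_invertible pd xa s)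
qed

text \<open>The singular parameters are relatively closed in \<open>[0, \<theta>\<^sub>N)\<close> by continuity. Hence they have a
  minimum if there are any, and \<open>\<tau>\<^sub>N\<close> is that minimum.\<close>

lemma below_tau_N:
  fixes D :: "real^'n^'q"
  assumes "0 \<le> \<theta>" "ereal \<theta> < tau_N TYPE('k::{finite,linorder}) A B C D"
  shows "ereal \<theta> < theta_N TYPE('k) A B C D"
    and "\<And>s. 0 \<le> s \<Longrightarrow> s \<le> \<theta> \<Longrightarrow> invertible (Omega_theta TYPE('k) s A B C D)"
proof -
  let ?Z = "singular_values_N TYPE('k) A B C D"
  have "ereal \<theta> < theta_N TYPE('k) A B C D \<and> (\<forall>s\<in>?Z. \<theta> < s)"
  proof (cases "?Z = {}")
    case True
    then show ?thesis using assms by (simp add: tau_N_def)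
  next
    case False
    then obtain a where a: "a \<in> ?Z" by blast
    then have a': "0 \<le> a" "ereal a < theta_N TYPE('k) A B C D" "\<not> invertible (Omega_theta TYPE('k) a A B C D)"
      by (auto simp: singular_values_N_def)
    \<comment> \<open>The singular values up to \<open>a\<close> form a compact set, so a least one exists.\<close>
    define K where "K = {0..a} \<inter> (\<lambda>s. det (Omega_theta TYPE('k) s A B C D)) -` {0}"
    have K: "s \<in> K \<longleftrightarrow> s \<in> {0..a} \<and> \<not> invertible (Omega_theta TYPE('k) s A B C D)" for s
      by (auto simp: K_def invertible_det_nz)
    have "continuous_on {0..a} (\<lambda>s. det (Omega_theta TYPE('k) s A B C D))"
      using continuous_on_Omega_theta[OF a'(2)] tendsto_det unfolding continuous_on_def by blast
    then have "closed K"
      unfolding K_def by (intro continuous_closed_preimage) auto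
    then have "compact K"
      unfolding K_def by (simp add: compact_eq_bounded_closed bounded_Int)
    moreover have "K \<noteq> {}"
      using a' K by auto
    ultimately have "\<exists>m\<in>K. \<forall>s\<in>K. m \<le> s"
      by (rule compact_attains_inf)
    then obtain m where m: "m \<in> K" "\<And>s. s \<in> K \<Longrightarrow> m \<le> s"
      by (elim bexE) simp
    have mZ: "m \<in> ?Z"
      using m(1) a'(2) by (auto simp: K singular_values_N_def intro: le_less_trans[of _ "ereal a"])
    have least: "m \<le> s" if "s \<in> ?Z" for s
    proof (cases "s \<le> a")
      case True
      then show ?thesis using that by (intro m(2)) (auto simp: K singular_values_N_def)
    next
      case False
      then show ?thesis using m(1) by (auto simp: K)
    qed
    have "(LEAST s. s \<in> ?Z) = m"
      by (rule Least_equality) (fact mZ, fact least)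
    then have "\<theta> < m"
      using assms(2) False by (simp add: tau_N_def)
    moreover have "ereal m < theta_N TYPE('k) A B C D"
      using mZ by (simp add: singular_values_N_def)
    ultimately show ?thesis
      using least less_trans[of "ereal \<theta>" "ereal m"] by (auto dest: less_le_trans)
  qed
  then show "ereal \<theta> < theta_N TYPE('k) A B C D"
    and "\<And>s. 0 \<le> s \<Longrightarrow> s \<le> \<theta> \<Longrightarrow> invertible (Omega_theta TYPE('k) s A B C D)"
    by (fastforce simp: singular_values_N_def intro: le_less_trans[of _ "ereal \<theta>"])+
qed

text \<open>At the least parameter where definiteness fails the matrix would be semidefinite with a null
  vector.\<close>

lemma pos_def_path:
  fixes f :: "real \<Rightarrow> real^'n^'n"
  assumes cont: "continuous_on {0..a} f" and sym: "\<And>s. s \<in> {0..a} \<Longrightarrow> transpose (f s) = f s"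
    and inv: "\<And>s. s \<in> {0..a} \<Longrightarrow> invertible (f s)" and "pos_def (f 0)" "0 \<le> a"
  shows "pos_def (f a)"
proof (rule ccontr)
  define K where "K = sphere (0 :: real^'n) 1 \<times> {0..a}"
  define g where "g = (\<lambda>(x, s). qform (f s) x)"
  define Z where "Z = K \<inter> g -` {..0}"
  have normalize: "qform M ((1 / norm x) *\<^sub>R x) = qform M x / (x \<bullet> x)" if "x \<noteq> 0" for x :: "real^'n" and M
    by (simp add: qform_scaleR power2_norm_eq_inner power_one_over)
  assume "\<not> pos_def (f a)"
  then obtain x where x: "x \<noteq> 0" "qform (f a) x \<le> 0"
    using sym[of a] assms(5) by (auto simp: pos_def_iff not_less)
  then have "qform (f a) ((1 / norm x) *\<^sub>R x) \<le> 0"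
    by (simp add: normalize divide_nonpos_nonneg)
  then have "((1 / norm x) *\<^sub>R x, a) \<in> Z"
    using x(1) assms(5) by (simp add: Z_def K_def g_def)
  then have "Z \<noteq> {}" by blast
  have K: "compact K"
    by (auto simp: K_def intro: compact_Times)
  have "continuous_on K g"
    unfolding g_def case_prod_beta continuous_on_def
  proof
    fix z assume "z \<in> K"
    have "continuous_on K (\<lambda>z. f (snd z))"
      by (rule continuous_on_compose2[OF cont]) (auto simp: K_def intro: continuous_intros)
    then have "((\<lambda>z. f (snd z)) \<longlongrightarrow> f (snd z)) (at z within K)"
      using \<open>z \<in> K\<close> by (simp add: continuous_on_def)
    then show "((\<lambda>z. qform (f (snd z)) (fst z)) \<longlongrightarrow> qform (f (snd z)) (fst z)) (at z within K)"
      by (intro tendsto_qform tendsto_intros)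
  qed
  then have "closed Z"
    unfolding Z_def using compact_imp_closed[OF K] by (intro continuous_closed_preimage) auto
  then have "compact Z"
    using K unfolding Z_def by (metis closed_Int_compact inf.left_idem inf_commute)
  then have "\<exists>z\<in>Z. \<forall>z'\<in>Z. snd z \<le> snd z'"
    by (rule continuous_attains_inf) (use \<open>Z \<noteq> {}\<close> in \<open>auto intro: continuous_intros\<close>)
  then obtain z where z: "z \<in> Z" "\<And>z'. z' \<in> Z \<Longrightarrow> snd z \<le> snd z'"
    by (elim bexE) simp
  obtain u s where us: "z = (u, s)" by force
  have s: "s \<in> {0..a}" and u: "norm u = 1" "qform (f s) u \<le> 0"
    using z(1) by (auto simp: us Z_def K_def g_def)
  have "s \<noteq> 0"
    using u assms(4) pos_def_pos[of "f 0" u] by force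
  define r where "r n = s * (1 - 1 / real (Suc n))" for n
  have r: "r n \<in> {0..a}" "r n < s" for n
  proof -
    have *: "0 \<le> 1 - 1 / real (Suc n)" "1 - 1 / real (Suc n) < 1"
      by (simp_all add: field_simps)
    show "r n < s"
      using * s \<open>s \<noteq> 0\<close> unfolding r_def by (simp del: of_nat_Suc)
    then show "r n \<in> {0..a}"
      using * s unfolding r_def by (auto simp del: of_nat_Suc)
  qed
  have "r \<longlonglongrightarrow> s * (1 - 0)"
    unfolding r_def by (intro tendsto_intros LIMSEQ_Suc[OF lim_1_over_n])
  then have "(\<lambda>n. f (r n)) \<longlonglongrightarrow> f s"
    using cont s r(1) unfolding continuous_on_sequentially comp_def by simp
  have nonneg: "0 \<le> qform (f s) x" for x
  proof (cases "x = 0")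
    case False
    have "0 \<le> qform (f (r n)) x" for n
    proof (rule ccontr)
      assume "\<not> ?thesis"
      then have "((1 / norm x) *\<^sub>R x, r n) \<in> Z"
        using False r(1)[of n] by (simp add: Z_def K_def g_def normalize divide_nonpos_nonneg)
      from z(2)[OF this] r(2)[of n] show False
        by (simp add: us)
    qed
    moreover have "(\<lambda>n. qform (f (r n)) x) \<longlonglongrightarrow> qform (f s) x"
      by (intro tendsto_qform tendsto_const) fact
    ultimately show ?thesis
      using LIMSEQ_le_const by blast
  qed simp
  have "f s *v u = 0"
    using nonneg u(2) by (intro psd_null_vector sym[OF s] antisym) auto
  then show False
    using inv[OF s] u(1) by (auto simp: invertible_ker)
qed

text \<open>The stacked observability matrix is injective because \<open>N\<close> is at least the state dimension.\<close>

lemma pos_def_Omega_N: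
  fixes A :: "real^'n^'n"
  assumes "is_observable C A" "CARD('n) \<le> CARD('k::{finite,linorder})"
  shows "pos_def (Omega_N TYPE('k) A B C)"
  unfolding pos_def_iff
proof (intro conjI allI impI Omega_N_symmetric)
  fix x :: "real^'n" assume "x \<noteq> 0"
  let ?Ob = "obs_block C A :: real^'n^('k \<times> _)"
  let ?H = "toeplitz_block C A B :: real^('k \<times> _)^('k \<times> _)"
  have "?Ob *v x \<noteq> 0"
  proof
    assume 0: "?Ob *v x = 0"
    have "C *v (matpow A k *v x) = 0" if k: "k < CARD('n)" for k
    proof -
      have "k \<in> range (\<lambda>i :: 'k. CARD('k) - pos i)"
        using bij_betw_imp_surj_on[OF bij_block_time[where 'k = 'k]] k assms(2) by simp
      then obtain i :: 'k where i: "k = CARD('k) - pos i"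
        by blast
      have "(C *v (matpow A k *v x)) $ b = (?Ob *v x) $ (i, b)" for b
        by (simp add: matrix_vector_mul_component obs_block_def i matrix_vector_mul_assoc)
      then show ?thesis
        by (simp add: 0 vec_eq_iff)
    qed
    then have "x = 0"
      by (rule observable_ker_zero[OF assms(1)])
    with \<open>x \<noteq> 0\<close> show False ..
  qed
  then have "0 < qform (matrix_inv (mat 1 + ?H ** transpose ?H)) (?Ob *v x)"
    by (intro pos_def_pos pos_def_matrix_inv pos_def_one_plus_gram')
  then show "0 < qform (Omega_N TYPE('k) A B C) x"
    using qform_congruence[of "transpose ?Ob" _ x] by (simp add: Omega_N_def Let_def)
qed

text \<open>The path from 0 to \<open>\<theta>\<close> contains no singular \<open>\<Omega>\<^sub>N\<^sup>s\<close>, so \<open>\<Omega>\<^sub>N\<^sup>\<theta>\<close> inherits definiteness from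
  \<open>\<Omega>\<^sub>N\<close>, and its form bounds the block cost from below for every noise.\<close>

lemma block_cost_coercive:
  fixes A :: "real^'n^'n" and B :: "real^'m^'n" and C :: "real^'n^'p" and D :: "real^'n^'q"
  assumes "is_observable C A" "CARD('n) \<le> CARD('k::{finite,linorder})"
    and "0 \<le> \<theta>" "ereal \<theta> < tau_N TYPE('k) A B C D"
  shows "\<exists>\<epsilon>>0. \<forall>x w. \<epsilon> * (x \<bullet> x) \<le> block_cost \<theta> A B C D x w CARD('k)"
proof -
  let ?LL = "LL_N A B C D :: real^('k \<times> 'q)^('k \<times> 'q)"
  let ?J = "J_N A B C D :: real^'n^('k \<times> 'q)"
  note below = below_tau_N[OF assms(3,4)]
  have T: "pos_def (mat 1 - \<theta> *\<^sub>R ?LL)"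
    by (rule pos_def_below_theta_N[OF assms(3) below(1)])
  have "pos_def (Omega_theta TYPE('k) \<theta> A B C D)"
  proof (rule pos_def_path[OF continuous_on_Omega_theta[OF below(1)]])
    show "pos_def (Omega_theta TYPE('k) 0 A B C D)"
      by (simp add: Omega_theta_def pos_def_Omega_N assms)
    show "transpose (Omega_theta TYPE('k) s A B C D) = Omega_theta TYPE('k) s A B C D" if "s \<in> {0..\<theta>}" for s
      using that below(1) by (intro Omega_theta_symmetric) (auto intro: le_less_trans[of _ "ereal \<theta>"])
  qed (use below(2) assms(3) in auto)
  then obtain \<epsilon> where \<epsilon>: "0 < \<epsilon>" "\<And>x. \<epsilon> * (x \<bullet> x) \<le> qform (Omega_theta TYPE('k) \<theta> A B C D) x"
    using pos_def_coercive by blast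
  have "qform (Omega_theta TYPE('k) \<theta> A B C D) x \<le> block_cost \<theta> A B C D x w CARD('k)" for x w
  proof -
    have "qform (Omega_theta TYPE('k) \<theta> A B C D) x
        = qform (Omega_N TYPE('k) A B C) x - \<theta> * qform (matrix_inv (mat 1 - \<theta> *\<^sub>R ?LL)) (?J *v x)"
      using qform_congruence[of "transpose ?J" _ x]
      by (simp add: Omega_theta_eq[OF assms(3) T] qform_minus qform_scaleR_matrix)
    also have "\<dots> \<le> block_cost \<theta> A B C D x w CARD('k)"
      unfolding block_cost_stack[where 'k = 'k] Omega_N_def Let_def J_N_def LL_N_def
      by (rule block_form_lower_bound[OF assms(3) T[unfolded LL_N_def Let_def]])
    finally show ?thesis .
  qed
  with \<epsilon> show ?thesis
    by (meson order_trans)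
qed

section \<open>The observer covariance is a supersolution\<close>

lemma schur_stable_scaled:
  assumes "0 < \<rho>" "spec_radius F \<noteq> 0 \<longrightarrow> \<rho> < 1 / spec_radius F"
  shows "schur_stable (\<rho> *\<^sub>R F)"
  unfolding schur_stable_def
proof
  fix c assume "c \<in> complex_eigenvalues (\<rho> *\<^sub>R F)"
  then obtain v where v: "v \<noteq> 0" "map_matrix complex_of_real (\<rho> *\<^sub>R F) *v v = c *s v"
    by (auto simp: complex_eigenvalues_def eigenvalues_def)
  have "map_matrix complex_of_real (\<rho> *\<^sub>R F) *v v
      = complex_of_real \<rho> *s (map_matrix complex_of_real F *v v)"
    by (simp add: matrix_vector_mult_def vec_eq_iff sum_distrib_left mult.assoc)
  with v(2) have "complex_of_real \<rho> *s (map_matrix complex_of_real F *v v) = c *s v"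
    by simp
  then have "map_matrix complex_of_real F *v v = (c / complex_of_real \<rho>) *s v"
    using assms(1) by (simp add: vec_eq_iff field_simps)
  with v(1) have "c / complex_of_real \<rho> \<in> complex_eigenvalues F"
    by (auto simp: complex_eigenvalues_def eigenvalues_def)
  then have le: "cmod c / \<rho> \<le> spec_radius F"
    using cmod_le_spec_radius assms(1) by (force simp: norm_divide)
  show "cmod c < 1"
  proof (cases "spec_radius F = 0")
    case True
    with le have "cmod c \<le> 0"
      using assms(1) by (simp add: divide_le_0_iff)
    then show ?thesis by simp
  next
    case False
    have "0 \<le> spec_radius F"
      using le assms(1) by (meson divide_nonneg_pos norm_ge_zero order_trans)
    with False have "0 < spec_radius F" by simp
    then have "\<rho> * spec_radius F < 1"
      using assms(2) False by (simp add: field_simps)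
    moreover have "cmod c \<le> \<rho> * spec_radius F"
      using le assms(1) by (simp add: field_simps)
    ultimately show ?thesis by simp
  qed
qed

text \<open>Rescaling by \<open>\<rho>\<close> turns the defining equation into a Stein equation with the stable matrix
  \<open>\<rho> (A - G C)\<close>. Where the form of its solution vanishes, \<open>B\<^sup>T\<close> and \<open>G\<^sup>T\<close> vanish too, so there
  \<open>(A - G C)\<^sup>T\<close> agrees with \<open>A\<^sup>T\<close> and reachability of \<open>(A, B)\<close> gives definiteness.\<close>

lemma Sigma_rho_properties:
  fixes A :: "real^'n^'n"
  assumes reach: "is_reachable A B" and "0 < \<rho>"
    and "spec_radius (A - G ** C) \<noteq> 0 \<longrightarrow> \<rho> < 1 / spec_radius (A - G ** C)"
  defines "S \<equiv> Sigma_rho \<rho> A B C G"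
  shows "pos_def S"
    and "\<And>z. qform S z = \<rho>\<^sup>2 * qform S (transpose (A - G ** C) *v z)
               + (transpose B *v z) \<bullet> (transpose B *v z) + (transpose G *v z) \<bullet> (transpose G *v z)"
proof -
  let ?F = "A - G ** C"
  let ?Q = "B ** transpose B + G ** transpose G"
  have stable: "schur_stable (\<rho> *\<^sub>R ?F)"
    by (rule schur_stable_scaled[OF assms(2,3)])
  have eq: "\<rho>\<^sup>2 *\<^sub>R (?F ** M ** transpose ?F) + B ** transpose B + G ** transpose G
      = (\<rho> *\<^sub>R ?F) ** M ** transpose (\<rho> *\<^sub>R ?F) + ?Q" for M
    by (simp add: transpose_scalar matrix_scalar_ac scalar_matrix_assoc[symmetric] power2_eq_square
        add.assoc)
  have S: "S = (\<rho> *\<^sub>R ?F) ** S ** transpose (\<rho> *\<^sub>R ?F) + ?Q"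
    unfolding S_def Sigma_rho_def eq by (rule theI'[OF stein_unique_solution[OF stable]])
  have Q: "qform ?Q z = (transpose B *v z) \<bullet> (transpose B *v z) + (transpose G *v z) \<bullet> (transpose G *v z)" for z
    by (simp add: qform_plus qform_gram')
  show qS: "qform S z = \<rho>\<^sup>2 * qform S (transpose ?F *v z)
      + (transpose B *v z) \<bullet> (transpose B *v z) + (transpose G *v z) \<bullet> (transpose G *v z)" for z
  proof -
    have "qform S z = qform ((\<rho> *\<^sub>R ?F) ** S ** transpose (\<rho> *\<^sub>R ?F) + ?Q) z"
      using S by (rule arg_cong)
    also have "\<dots> = qform S (transpose (\<rho> *\<^sub>R ?F) *v z) + qform ?Q z"
      by (simp only: qform_plus qform_congruence)
    finally show ?thesis
      by (simp add: Q transpose_scalar scaleR_matrix_vector_assoc[symmetric] qform_scaleR)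
  qed
  have sym: "transpose S = S"
    by (rule stein_symmetric[OF stable _ S]) (simp add: transpose_plus matrix_transpose_mul)
  have nonneg: "0 \<le> qform S z" for z
    by (rule stein_nonneg[OF stable _ S]) (simp add: Q)
  show "pos_def S"
    unfolding pos_def_iff
  proof (intro conjI allI impI sym)
    fix z :: "real^'n" assume "z \<noteq> 0"
    show "0 < qform S z"
    proof (rule ccontr)
      assume "\<not> ?thesis"
      then have z: "qform S z = 0"
        using nonneg[of z] by simp
      have null: "qform S (transpose A *v y) = 0 \<and> transpose B *v y = 0" if y: "qform S y = 0" for y
      proof -
        have "0 \<le> \<rho>\<^sup>2 * qform S (transpose ?F *v y)"
          using nonneg by simp
        then have 0: "\<rho>\<^sup>2 * qform S (transpose ?F *v y) = 0" "(transpose B *v y) \<bullet> (transpose B *v y) = 0"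
          "(transpose G *v y) \<bullet> (transpose G *v y) = 0"
          using qS[of y] y inner_ge_zero[of "transpose B *v y"] inner_ge_zero[of "transpose G *v y"]
          by linarith+
        then have "transpose ?F *v y = transpose A *v y"
          by (simp add: transpose_minus matrix_transpose_mul matrix_vector_mult_diff_rdistrib
              matrix_vector_mul_assoc[symmetric])
        with 0 show ?thesis
          using assms(2) by simp
      qed
      have "z = 0"
        by (rule reachable_invariant_zero[OF reach, of z "{y. qform S y = 0}"]) (use z null in auto)
      with \<open>z \<noteq> 0\<close> show False ..
    qed
  qed
qed

lemma theta_le_beta_rho:
  fixes A :: "real^'n^'n" and B :: "real^'m^'n" and C :: "real^'n^'p" and D :: "real^'n^'q"
    and G :: "real^'p^'n" and \<rho> :: real
  defines "S \<equiv> Sigma_rho \<rho> A B C G"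
  assumes S: "pos_def S" and "1 < \<rho>" "0 \<le> \<theta>" "\<theta> \<le> beta_rho \<rho> A B C D G"
  shows "\<theta> * ((D *v x) \<bullet> (D *v x)) \<le> (1 - 1 / \<rho>\<^sup>2) * qform (matrix_inv S) x"
proof -
  define l where "l = lambda_max (D ** S ** transpose D)"
  have sym: "transpose (D ** S ** transpose D) = D ** S ** transpose D"
    by (simp add: matrix_transpose_mul matrix_mul_assoc pos_def_symmetric[OF S])
  have le: "qform S (transpose D *v u) \<le> l * (u \<bullet> u)" for u
    using qform_le_lambda_max[OF sym, of u] by (simp add: l_def qform_congruence)
  have "0 \<le> l"
    using order_trans[OF pos_def_nonneg[OF S] le[of "axis undefined 1"]] by (simp add: inner_axis_axis)
  have D: "(D *v x) \<bullet> (D *v x) \<le> l * qform (matrix_inv S) x"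
    by (rule gram_le_of_congruence_le[OF S le \<open>0 \<le> l\<close>])
  have q: "0 \<le> qform (matrix_inv S) x"
    by (rule pos_def_nonneg[OF pos_def_matrix_inv[OF S]])
  have \<beta>: "\<theta> \<le> (\<rho>\<^sup>2 - 1) / (\<rho>\<^sup>2 * l)"
    using assms(5) by (simp add: beta_rho_def S_def l_def)
  have \<rho>2: "1 < \<rho>\<^sup>2"
    using assms(3) by (simp add: one_less_power)
  have "\<theta> * l \<le> 1 - 1 / \<rho>\<^sup>2"
  proof (cases "l = 0")
    \<comment> \<open>\<open>l = 0\<close> is a separate case since \<open>\<beta>\<^sub>\<rho>\<close> divides by \<open>l\<close>.\<close>
    case True
    then show ?thesis using \<rho>2 by (simp add: divide_le_eq)
  next
    case False
    then have "\<theta> * l \<le> (\<rho>\<^sup>2 - 1) / (\<rho>\<^sup>2 * l) * l"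
      using \<beta> \<open>0 \<le> l\<close> by (intro mult_right_mono)
    also have "\<dots> = (\<rho>\<^sup>2 - 1) / \<rho>\<^sup>2"
      using False by simp
    finally show ?thesis
      using assms(3) by (auto simp: diff_divide_distrib split: if_splits)
  qed
  have "\<theta> * ((D *v x) \<bullet> (D *v x)) \<le> \<theta> * (l * qform (matrix_inv S) x)"
    by (intro mult_left_mono D assms)
  also have "\<dots> = (\<theta> * l) * qform (matrix_inv S) x"
    by simp
  also have "\<dots> \<le> (1 - 1 / \<rho>\<^sup>2) * qform (matrix_inv S) x"
    by (intro mult_right_mono q) fact
  finally show ?thesis .
qed

text \<open>Bounding \<open>\<theta> D\<^sup>T D\<close> by \<open>(1 - \<rho>\<^sup>-\<^sup>2) \<Sigma>\<inverse>\<close> leaves \<open>\<rho>\<^sup>-\<^sup>2 \<Sigma>\<inverse> + C\<^sup>T C\<close> in the Riccati map. This is a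
  Kalman filter step from the inflated covariance \<open>\<rho>\<^sup>2 \<Sigma>\<close>, and the fixed-gain observer \<open>G\<close>, whose
  error covariance after that step is \<open>\<Sigma>\<close> again, cannot beat the optimal gain.\<close>

lemma Sigma_rho_supersolution:
  fixes A :: "real^'n^'n" and D :: "real^'n^'q"
  assumes reach: "is_reachable A B" and \<rho>: "1 < \<rho>"
    and stable: "spec_radius (A - G ** C) \<noteq> 0 \<longrightarrow> \<rho> < 1 / spec_radius (A - G ** C)"
    and \<theta>: "0 \<le> \<theta>" "\<theta> \<le> beta_rho \<rho> A B C D G"
  defines "S \<equiv> Sigma_rho \<rho> A B C G"
  shows "pos_def S" and "pos_def (V_inv \<theta> D S)"
    and "\<And>z. qform (riccati \<theta> A B C D S) z \<le> qform S z"
proof -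
  have \<rho>0: "0 < \<rho>"
    using \<rho> by simp
  note Sigma = Sigma_rho_properties[OF reach \<rho>0 stable, folded S_def]
  show pdS: "pos_def S"
    by (rule Sigma(1))
  have bound: "\<theta> * ((D *v x) \<bullet> (D *v x)) \<le> (1 - 1 / \<rho>\<^sup>2) * qform (matrix_inv S) x" for x
    using theta_le_beta_rho[OF Sigma(1)[unfolded S_def] \<rho> \<theta>] by (simp add: S_def)
  have V: "1 / \<rho>\<^sup>2 * qform (matrix_inv S) x \<le> qform (V_inv \<theta> D S) x" for x
    using bound[of x] by (simp add: qform_V_inv algebra_simps)
  show pdV: "pos_def (V_inv \<theta> D S)"
    unfolding pos_def_iff
  proof (intro conjI allI impI V_inv_symmetric[OF pdS])
    fix x :: "real^'n" assume "x \<noteq> 0"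
    then have "0 < 1 / \<rho>\<^sup>2 * qform (matrix_inv S) x"
      using pos_def_pos[OF pos_def_matrix_inv[OF pdS]] \<rho>0 by simp
    with V[of x] show "0 < qform (V_inv \<theta> D S) x" by simp
  qed
  let ?M = "stage_info \<theta> C D S"
  have pdM: "pos_def ?M"
    by (rule pos_def_stage_info[OF pdV])
  fix z :: "real^'n"
  define f where "f = transpose (A - G ** C) *v z"
  define g where "g = transpose G *v z"
  define y where "y = matrix_inv ?M *v (transpose A *v z)"
  have Az: "transpose A *v z = f + transpose C *v g"
    by (simp add: f_def g_def transpose_minus matrix_transpose_mul matrix_vector_mult_diff_rdistrib
        matrix_vector_mul_assoc)
  have "2 * (y \<bullet> (transpose A *v z)) = 2 * (y \<bullet> f) + 2 * ((C *v y) \<bullet> g)"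
    by (simp add: Az inner_add_right inner_transpose_mult)
  moreover have "2 * (y \<bullet> f) \<le> 1 / \<rho>\<^sup>2 * qform (matrix_inv S) y + \<rho>\<^sup>2 * qform S f"
    using young_pos_def[OF pdS, of "(1 / \<rho>) *\<^sub>R y" "\<rho> *\<^sub>R f"] \<rho>0
    by (simp add: qform_scaleR power_one_over)
  moreover have "2 * ((C *v y) \<bullet> g) \<le> (C *v y) \<bullet> (C *v y) + g \<bullet> g"
    using inner_ge_zero[of "C *v y - g"] by (simp add: inner_diff_left inner_diff_right inner_commute)
  moreover have "qform ?M y = qform (V_inv \<theta> D S) y + (C *v y) \<bullet> (C *v y)"
    by (simp add: stage_info_V_inv qform_plus qform_gram)
  moreover have "y \<bullet> (transpose A *v z) = qform ?M y"
    using qform_matrix_inv_attains[OF pdM, of "transpose A *v z"] by (simp add: y_def inner_commute)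
  moreover have "qform (matrix_inv ?M) (transpose A *v z) = qform ?M y"
    using qform_matrix_inv_attains[OF pdM, of "transpose A *v z"] by (simp add: qform_def y_def)
  ultimately show "qform (riccati \<theta> A B C D S) z \<le> qform S z"
    using V[of y] unfolding qform_riccati Sigma(2)[of z] f_def[symmetric] g_def[symmetric] by linarith
qed

section \<open>Iteration below a supersolution\<close>

lemma tendsto_V_inv:
  assumes "(p \<longlongrightarrow> P) F" "pos_def P" "\<And>t. pos_def (p t)"
  shows "((\<lambda>t. V_inv \<theta> D (p t)) \<longlongrightarrow> V_inv \<theta> D P) F"
  unfolding V_inv_def by (intro tendsto_intros tendsto_matrix_inv assms pos_def_invertible)

lemma tendsto_riccati:
  assumes "(p \<longlongrightarrow> P) F" "pos_def P" "\<And>t. pos_def (p t)"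
    and "pos_def (V_inv \<theta> D P)" "\<And>t. pos_def (V_inv \<theta> D (p t))"
  shows "((\<lambda>t. riccati \<theta> A B C D (p t)) \<longlongrightarrow> riccati \<theta> A B C D P) F"
  unfolding riccati_stage_info stage_info_V_inv
  by (intro tendsto_intros tendsto_matrix_mult tendsto_matrix_inv tendsto_V_inv assms
      pos_def_invertible pos_def_stage_info[unfolded stage_info_V_inv])

lemma below_supersolution:
  assumes reach: "is_reachable A B" and S: "pos_def S" "pos_def (V_inv \<theta> D S)"
    and P: "pos_def P" "\<And>x. qform P x \<le> qform S x"
  shows "pos_def (V_inv \<theta> D P)" "pos_def (riccati \<theta> A B C D P)"
    "qform (riccati \<theta> A B C D P) x \<le> qform (riccati \<theta> A B C D S) x"
proof -
  show V: "pos_def (V_inv \<theta> D P)"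
    using qform_V_inv_antimono[OF P(1) S(1) P(2)] pos_def_pos[OF S(2)] V_inv_symmetric[OF P(1)]
    unfolding pos_def_iff by (meson less_le_trans)
  show "pos_def (riccati \<theta> A B C D P)"
    by (rule pos_def_riccati[OF reach V])
  show "qform (riccati \<theta> A B C D P) x \<le> qform (riccati \<theta> A B C D S) x"
    by (rule riccati_mono[OF P(1) S(1) P(2) V S(2)])
qed

text \<open>Below \<open>S\<close> the measurement term is bounded by \<open>C\<^sup>T C \<le> c S\<inverse> \<le> c P\<inverse>\<close>, so the measurement
  update shrinks \<open>P\<close> at most by the factor \<open>1 / (1 + c)\<close>, uniformly in \<open>P\<close>. The resulting bound passes
  to limits, where it makes the null space of the limit invariant under \<open>A\<^sup>T\<close>.\<close>

lemma riccati_lower_bound: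
  fixes S :: "real^'n^'n"
  assumes S: "pos_def S" "pos_def (V_inv \<theta> D S)" and "is_reachable A B" "0 \<le> \<theta>"
  shows "\<exists>\<delta>>0. \<forall>P z. pos_def P \<longrightarrow> (\<forall>x. qform P x \<le> qform S x) \<longrightarrow>
    \<delta> * qform P (transpose A *v z) + (transpose B *v z) \<bullet> (transpose B *v z) \<le> qform (riccati \<theta> A B C D P) z"
proof -
  obtain c where c: "0 < c" "\<And>x. qform (transpose C ** C) x \<le> c * qform (matrix_inv S) x"
    using qform_le_multiple_pos_def[OF pos_def_matrix_inv[OF S(1)]] by blast
  define \<delta> where "\<delta> = 1 / (1 + c)"
  have "\<delta> * qform P (transpose A *v z) + (transpose B *v z) \<bullet> (transpose B *v z) \<le> qform (riccati \<theta> A B C D P) z"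
    if P: "pos_def P" "\<And>x. qform P x \<le> qform S x" for P z
  proof -
    let ?M = "stage_info \<theta> C D P"
    define x where "x = transpose A *v z"
    have pdM: "pos_def ?M"
      by (rule pos_def_stage_info[OF below_supersolution(1)[OF assms(3) S P]])
    have M: "qform ?M y \<le> (1 + c) * qform (matrix_inv P) y" for y
    proof -
      have "(C *v y) \<bullet> (C *v y) \<le> c * qform (matrix_inv S) y"
        using c(2)[of y] by (simp add: qform_gram)
      also have "\<dots> \<le> c * qform (matrix_inv P) y"
        using c(1) by (intro mult_left_mono qform_matrix_inv_antimono P S) simp
      finally have "(C *v y) \<bullet> (C *v y) \<le> c * qform (matrix_inv P) y" .
      moreover have "0 \<le> \<theta> * ((D *v y) \<bullet> (D *v y))"
        using assms(4) by simp
      ultimately show ?thesis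
        by (simp add: qform_stage_info algebra_simps)
    qed
    have "2 * (x \<bullet> (\<delta> *\<^sub>R (P *v x))) \<le> qform (matrix_inv ?M) x + qform ?M (\<delta> *\<^sub>R (P *v x))"
      by (rule young_pos_def[OF pdM])
    also have "qform ?M (\<delta> *\<^sub>R (P *v x)) \<le> (1 + c) * (\<delta>\<^sup>2 * qform (matrix_inv P) (P *v x))"
      using M[of "\<delta> *\<^sub>R (P *v x)"] by (simp add: qform_scaleR)
    also have "\<dots> = \<delta> * qform P x"
    proof -
      have "(1 + c) * (\<delta>\<^sup>2 * qform P x) = ((1 + c) * \<delta>) * (\<delta> * qform P x)"
        by (simp add: power2_eq_square)
      moreover have "(1 + c) * \<delta> = 1"
        using c(1) by (simp add: \<delta>_def)
      ultimately show ?thesis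
        by (simp add: qform_matrix_inv pos_def_invertible pos_def_symmetric P(1))
    qed
    finally have "\<delta> * qform P x \<le> qform (matrix_inv ?M) x"
      by (simp add: qform_def)
    then show ?thesis
      by (simp add: qform_riccati x_def)
  qed
  moreover have "0 < \<delta>"
    using c(1) by (simp add: \<delta>_def)
  ultimately show ?thesis by blast
qed

text \<open>Monotonicity makes the orbit of a supersolution decrease. The preceding bound makes its limit
  definite, and then continuity makes the limit a fixed point.\<close>

lemma supersolution_orbit_converges:
  fixes S :: "real^'n^'n"
  assumes reach: "is_reachable A B" and \<theta>: "0 \<le> \<theta>"
    and S: "pos_def S" "pos_def (V_inv \<theta> D S)" "\<And>x. qform (riccati \<theta> A B C D S) x \<le> qform S x"
  shows "\<exists>P. pos_def P \<and> pos_def (V_inv \<theta> D P) \<and> riccati \<theta> A B C D P = P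
    \<and> (\<lambda>t. (riccati \<theta> A B C D ^^ t) S) \<longlonglongrightarrow> P"
proof -
  define s where "s t = (riccati \<theta> A B C D ^^ t) S" for t
  have s_Suc: "s (Suc t) = riccati \<theta> A B C D (s t)" for t
    by (simp add: s_def)
  have s: "pos_def (s t) \<and> (\<forall>x. qform (s t) x \<le> qform S x) \<and> (\<forall>x. qform (s (Suc t)) x \<le> qform (s t) x)" for t
  proof (induction t)
    case 0
    show ?case using S by (simp add: s_def)
  next
    case (Suc t)
    then have IH: "pos_def (s t)" "\<And>x. qform (s t) x \<le> qform S x" "\<And>x. qform (s (Suc t)) x \<le> qform (s t) x"
      by auto
    note b = below_supersolution[OF reach S(1,2) IH(1,2)]
    have pd: "pos_def (s (Suc t))"
      unfolding s_Suc by (rule b(2))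
    have le: "qform (s (Suc t)) x \<le> qform S x" for x
      using IH(2,3) order_trans by blast
    have "qform (riccati \<theta> A B C D (s (Suc t))) x \<le> qform (riccati \<theta> A B C D (s t)) x" for x
      by (rule below_supersolution(3)[OF reach IH(1) b(1) pd IH(3)])
    with pd le show ?case by (simp add: s_Suc)
  qed
  have pd: "pos_def (s t)" and leS: "qform (s t) x \<le> qform S x" for t x
    using s by blast+
  have V: "pos_def (V_inv \<theta> D (s t))" for t
    by (rule below_supersolution(1)[OF reach S(1,2) pd leS])
  have "convergent (\<lambda>t. qform (s t) x)" for x
    by (rule Bseq_monoseq_convergent[OF BseqI'[of _ "qform S x"]])
      (use s pos_def_nonneg[OF pd] in \<open>auto simp: monoseq_Suc\<close>)
  then obtain P where P: "transpose P = P" "s \<longlonglongrightarrow> P"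
    using symmetric_limit_exists[of s] pos_def_symmetric[OF pd] by blast
  have lim: "(\<lambda>t. qform (s t) x) \<longlonglongrightarrow> qform P x" for x
    by (intro tendsto_qform P tendsto_const)
  have nonneg: "0 \<le> qform P x" for x
    by (rule LIMSEQ_le_const[OF lim]) (use pos_def_nonneg[OF pd] in auto)
  have PS: "qform P x \<le> qform S x" for x
    by (rule LIMSEQ_le_const2[OF lim]) (use leS in auto)
  obtain \<delta> where \<delta>: "0 < \<delta>" "\<And>P z. pos_def P \<Longrightarrow> (\<And>x. qform P x \<le> qform S x) \<Longrightarrow>
    \<delta> * qform P (transpose A *v z) + (transpose B *v z) \<bullet> (transpose B *v z) \<le> qform (riccati \<theta> A B C D P) z"
    using riccati_lower_bound[OF S(1,2) reach \<theta>, of C] by blast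
  have lower: "\<delta> * qform P (transpose A *v z) + (transpose B *v z) \<bullet> (transpose B *v z) \<le> qform P z" for z
  proof (rule LIMSEQ_le)
    show "(\<lambda>t. \<delta> * qform (s t) (transpose A *v z) + (transpose B *v z) \<bullet> (transpose B *v z))
        \<longlonglongrightarrow> \<delta> * qform P (transpose A *v z) + (transpose B *v z) \<bullet> (transpose B *v z)"
      by (intro tendsto_intros lim)
    show "(\<lambda>t. qform (s (Suc t)) z) \<longlonglongrightarrow> qform P z"
      by (rule LIMSEQ_Suc[OF lim])
    show "\<exists>N. \<forall>t\<ge>N. \<delta> * qform (s t) (transpose A *v z) + (transpose B *v z) \<bullet> (transpose B *v z)
        \<le> qform (s (Suc t)) z"
      using \<delta>(2)[OF pd leS] by (auto simp: s_Suc)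
  qed
  have null: "qform P (transpose A *v y) = 0 \<and> transpose B *v y = 0" if y: "qform P y = 0" for y
  proof -
    have "0 \<le> \<delta> * qform P (transpose A *v y)"
      using nonneg \<delta>(1) by simp
    with lower[of y] y inner_ge_zero[of "transpose B *v y"]
    have "\<delta> * qform P (transpose A *v y) = 0" "(transpose B *v y) \<bullet> (transpose B *v y) = 0"
      by linarith+
    then show ?thesis
      using \<delta>(1) by simp
  qed
  have pdP: "pos_def P"
    unfolding pos_def_iff
  proof (intro conjI allI impI P(1), rule ccontr)
    fix z :: "real^'n" assume "z \<noteq> 0" "\<not> 0 < qform P z"
    then have "qform P z = 0"
      using nonneg[of z] by simp
    then have "z = 0"
      by (intro reachable_invariant_zero[OF reach, of z "{y. qform P y = 0}"]) (use null in auto)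
    with \<open>z \<noteq> 0\<close> show False ..
  qed
  have VP: "pos_def (V_inv \<theta> D P)"
    by (rule below_supersolution(1)[OF reach S(1,2) pdP PS])
  have "(\<lambda>t. riccati \<theta> A B C D (s t)) \<longlonglongrightarrow> riccati \<theta> A B C D P"
    by (rule tendsto_riccati[OF P(2) pdP pd VP V])
  moreover have "(\<lambda>t. riccati \<theta> A B C D (s t)) \<longlonglongrightarrow> P"
    using LIMSEQ_Suc[OF P(2)] by (simp add: s_Suc)
  ultimately have "riccati \<theta> A B C D P = P"
    using LIMSEQ_unique by blast
  with pdP VP P(2) show ?thesis
    unfolding s_def by blast
qed

lemma orbit_below_supersolution:
  fixes S :: "real^'n^'n"
  assumes reach: "is_reachable A B"
    and S: "pos_def S" "pos_def (V_inv \<theta> D S)" "\<And>x. qform (riccati \<theta> A B C D S) x \<le> qform S x"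
    and p: "pos_def (p 0)" "\<And>x. qform (p 0) x \<le> qform S x" "\<And>t. p (Suc t) = riccati \<theta> A B C D (p t)"
  shows "admissible_orbit \<theta> A B C D p"
    and "\<And>t x. qform (p t) x \<le> qform ((riccati \<theta> A B C D ^^ t) S) x"
proof -
  let ?s = "\<lambda>t. (riccati \<theta> A B C D ^^ t) S"
  have *: "pos_def (?s t) \<and> (\<forall>x. qform (?s t) x \<le> qform S x) \<and> pos_def (p t) \<and> (\<forall>x. qform (p t) x \<le> qform (?s t) x)" for t
  proof (induction t)
    case 0
    show ?case using S p by simp
  next
    case (Suc t)
    then have IH: "pos_def (?s t)" "\<And>x. qform (?s t) x \<le> qform S x" "pos_def (p t)" "\<And>x. qform (p t) x \<le> qform (?s t) x"
      by auto
    note b = below_supersolution[OF reach S(1,2) IH(1,2)]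
    note c = below_supersolution[OF reach IH(1) b(1) IH(3,4)]
    have "pos_def (riccati \<theta> A B C D (?s t))" "pos_def (riccati \<theta> A B C D (p t))"
      by (rule b(2), rule c(2))
    moreover have "qform (riccati \<theta> A B C D (?s t)) x \<le> qform S x" for x
      by (rule order_trans[OF b(3) S(3)])
    moreover have "qform (riccati \<theta> A B C D (p t)) x \<le> qform (riccati \<theta> A B C D (?s t)) x" for x
      by (rule c(3))
    ultimately show ?case
      by (simp add: p(3))
  qed
  show "qform (p t) x \<le> qform (?s t) x" for t x
    using * by blast
  have "pos_def (V_inv \<theta> D (p t))" for t
    by (rule below_supersolution(1)[OF reach S(1,2)]) (use * order_trans in blast)+
  with * p(3) show "admissible_orbit \<theta> A B C D p"
    by (simp add: admissible_orbit_def)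
qed

text \<open>The orbit is squeezed: contraction bounds \<open>p\<^sub>t\<inverse>\<close> by \<open>b\<^sub>t P\<inverse>\<close> with \<open>b\<^sub>t \<rightarrow> 1\<close>, and
  monotonicity keeps \<open>p\<^sub>t\<close> below the orbit of the supersolution.\<close>

lemma orbit_converges:
  fixes P :: "real^'n^'n"
  assumes reach: "is_reachable A B"
    and P: "pos_def P" "pos_def (V_inv \<theta> D P)" "riccati \<theta> A B C D P = P"
    and \<epsilon>: "0 < \<epsilon>" "\<And>x w. \<epsilon> * (x \<bullet> x) \<le> block_cost \<theta> A B C D x w N" "0 < N"
    and p: "admissible_orbit \<theta> A B C D p"
    and s: "s \<longlonglongrightarrow> P" "\<And>t x. qform (p t) x \<le> qform (s t) x"
  shows "p \<longlonglongrightarrow> P"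
proof (rule tendsto_symmetricI)
  have pd: "pos_def (p t)" for t
    using p by (simp add: admissible_orbit_def)
  show "transpose (p t) = p t" for t
    by (rule pos_def_symmetric[OF pd])
  show "transpose P = P"
    by (rule pos_def_symmetric[OF P(1)])
  fix x
  obtain b where b: "b \<longlonglongrightarrow> 1" "\<And>t. 1 \<le> b t"
    "\<And>t x. qform (matrix_inv (p t)) x \<le> b t * qform (matrix_inv P) x"
    using orbit_inv_eventually_le[OF reach P \<epsilon>(1,2) p \<epsilon>(3)] by blast
  have low: "qform P x / b t \<le> qform (p t) x" for t
    using qform_matrix_inv_bound[OF pd b(3) P(1), of t x] b(2)[of t] by (simp add: field_simps)
  show "(\<lambda>t. qform (p t) x) \<longlonglongrightarrow> qform P x"
  proof (rule tendsto_sandwich)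
    have "(\<lambda>t. qform P x / b t) \<longlonglongrightarrow> qform P x / 1"
      by (intro tendsto_intros b) simp
    then show "(\<lambda>t. qform P x / b t) \<longlonglongrightarrow> qform P x" by simp
    show "(\<lambda>t. qform (s t) x) \<longlonglongrightarrow> qform P x"
      by (intro tendsto_qform s tendsto_const)
  qed (use low s(2) in auto)
qed

section \<open>The limiting gain\<close>

lemma pos_def_innovation:
  assumes "pos_def V" shows "pos_def (C ** V ** transpose C + mat 1)"
  using pos_def_nonneg[OF assms] pos_def_symmetric[OF assms]
  by (auto simp: pos_def_iff transpose_plus matrix_transpose_mul matrix_mul_assoc qform_plus
      qform_congruence intro: add_nonneg_pos)

lemma tendsto_gain:
  assumes "(p \<longlongrightarrow> P) F" "pos_def P" "\<And>t. pos_def (p t)"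
    and "pos_def (V_inv \<theta> D P)" "\<And>t. pos_def (V_inv \<theta> D (p t))"
  shows "((\<lambda>t. gain \<theta> A C D (p t)) \<longlongrightarrow> gain \<theta> A C D P) F"
  unfolding gain_def Let_def
  by (intro tendsto_intros tendsto_matrix_mult tendsto_matrix_inv tendsto_V_inv assms
      pos_def_invertible pos_def_innovation pos_def_matrix_inv)

lemma complex_eigenvalues_transpose: "complex_eigenvalues (transpose M) = complex_eigenvalues M"
proof -
  have char: "c \<in> complex_eigenvalues M \<longleftrightarrow> det (map_matrix complex_of_real M - mat c) = 0" for c and M :: "real^'a^'a"
  proof -
    have "(map_matrix complex_of_real M - mat c) *v v = 0 \<longleftrightarrow> map_matrix complex_of_real M *v v = c *s v" for v
      by (simp add: matrix_vector_mult_diff_rdistrib mat_vector_mult)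
    then have "c \<in> complex_eigenvalues M \<longleftrightarrow> \<not> invertible (map_matrix complex_of_real M - mat c)"
      by (auto simp: complex_eigenvalues_def eigenvalues_def invertible_ker)
    then show ?thesis
      by (simp add: invertible_det_nz)
  qed
  have "map_matrix complex_of_real (transpose M) - mat c = transpose (map_matrix complex_of_real M - mat c)" for c
    by (auto simp: transpose_def vec_eq_iff mat_def)
  then show ?thesis
    using char[of _ M] char[of _ "transpose M"] by auto
qed

text \<open>A left eigenvector of \<open>A - K C\<close> for an eigenvalue of modulus at least 1 would, by the Lyapunov
  inequality, be annihilated by \<open>K\<^sup>T\<close> and \<open>B\<^sup>T\<close>, hence be a left eigenvector of \<open>A\<close>
  orthogonal to the range of \<open>B\<close>. Its real and imaginary parts span an \<open>A\<^sup>T\<close>-invariant space, which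
  reachability excludes.\<close>

lemma schur_stable_of_lyapunov_inequality:
  fixes A :: "real^'n^'n" and K :: "real^'p^'n" and C :: "real^'n^'p"
  assumes reach: "is_reachable A B" and P: "pos_def P"
    and lyap: "\<And>z. qform P (transpose (A - K ** C) *v z) + (transpose K *v z) \<bullet> (transpose K *v z)
                  + (transpose B *v z) \<bullet> (transpose B *v z) \<le> qform P z"
  shows "schur_stable (A - K ** C)"
  unfolding schur_stable_def
proof
  let ?F = "transpose (A - K ** C)"
  fix c assume "c \<in> complex_eigenvalues (A - K ** C)"
  then have "c \<in> complex_eigenvalues ?F"
    by (simp add: complex_eigenvalues_transpose)
  then obtain v where v: "v \<noteq> 0" "map_matrix complex_of_real ?F *v v = c *s v"
    by (auto simp: complex_eigenvalues_def eigenvalues_def)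
  define a where "a = (\<chi> i. Re (v $ i))"
  define b where "b = (\<chi> i. Im (v $ i))"
  have comp: "(\<Sum>j\<in>UNIV. complex_of_real (?F $ i $ j) * v $ j) = c * v $ i" for i
    using v(2) by (simp add: matrix_vector_mult_def vec_eq_iff)
  have Fa: "?F *v a = Re c *\<^sub>R a - Im c *\<^sub>R b"
  proof (rule vec_eq_iff[THEN iffD2], rule allI)
    show "(?F *v a) $ i = (Re c *\<^sub>R a - Im c *\<^sub>R b) $ i" for i
      using arg_cong[OF comp[of i], of Re] by (simp add: a_def b_def matrix_vector_mult_def)
  qed
  have Fb: "?F *v b = Im c *\<^sub>R a + Re c *\<^sub>R b"
  proof (rule vec_eq_iff[THEN iffD2], rule allI)
    show "(?F *v b) $ i = (Im c *\<^sub>R a + Re c *\<^sub>R b) $ i" for i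
      using arg_cong[OF comp[of i], of Im] by (simp add: a_def b_def matrix_vector_mult_def)
  qed
  have rotate: "qform P (?F *v a) + qform P (?F *v b) = (cmod c)\<^sup>2 * (qform P a + qform P b)"
    unfolding Fa Fb qform_add_vector[OF pos_def_symmetric[OF P]] qform_diff_vector[OF pos_def_symmetric[OF P]]
    by (simp add: qform_scaleR matrix_vector_mult_scaleR cmod_power2 algebra_simps)
  show "cmod c < 1"
  proof (rule ccontr)
    assume "\<not> ?thesis"
    then have "1 \<le> (cmod c)\<^sup>2"
      by simp
    then have "1 * (qform P a + qform P b) \<le> (cmod c)\<^sup>2 * (qform P a + qform P b)"
      by (intro mult_right_mono) (simp_all add: pos_def_nonneg[OF P])
    then have "qform P a + qform P b \<le> qform P (?F *v a) + qform P (?F *v b)"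
      using rotate by simp
    then have "(transpose K *v a) \<bullet> (transpose K *v a) = 0" "(transpose K *v b) \<bullet> (transpose K *v b) = 0"
      "(transpose B *v a) \<bullet> (transpose B *v a) = 0" "(transpose B *v b) \<bullet> (transpose B *v b) = 0"
      using lyap[of a] lyap[of b] inner_ge_zero[of "transpose K *v a"] inner_ge_zero[of "transpose K *v b"]
        inner_ge_zero[of "transpose B *v a"] inner_ge_zero[of "transpose B *v b"] by linarith+
    then have K0: "transpose K *v a = 0" "transpose K *v b = 0"
      and B0: "transpose B *v a = 0" "transpose B *v b = 0"
      by simp_all
    have F: "?F *v z = transpose A *v z - transpose C *v (transpose K *v z)" for z
      by (simp add: transpose_minus matrix_transpose_mul matrix_vector_mult_diff_rdistrib
          matrix_vector_mul_assoc)
    have Aa: "transpose A *v a = Re c *\<^sub>R a - Im c *\<^sub>R b" and Ab: "transpose A *v b = Im c *\<^sub>R a + Re c *\<^sub>R b"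
      using Fa Fb by (simp_all add: F K0)
    have zero: "z = 0" if "z \<in> range (\<lambda>(s, t). s *\<^sub>R a + t *\<^sub>R b)" for z
    proof (rule reachable_invariant_zero[OF reach that])
      fix z assume "z \<in> range (\<lambda>(s, t). s *\<^sub>R a + t *\<^sub>R b)"
      then obtain s t where z: "z = s *\<^sub>R a + t *\<^sub>R b" by auto
      show "transpose B *v z = 0"
        by (simp add: z matrix_vector_right_distrib matrix_vector_mult_scaleR B0)
      have "transpose A *v z = (s * Re c + t * Im c) *\<^sub>R a + (t * Re c - s * Im c) *\<^sub>R b"
        by (simp add: z matrix_vector_right_distrib matrix_vector_mult_scaleR Aa Ab algebra_simps)
      then show "transpose A *v z \<in> range (\<lambda>(s, t). s *\<^sub>R a + t *\<^sub>R b)"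
        by (auto intro: range_eqI[of _ _ "(s * Re c + t * Im c, t * Re c - s * Im c)"])
    qed
    have "a = 0"
      by (rule zero) (auto intro: range_eqI[of _ _ "(1, 0)"])
    moreover have "b = 0"
      by (rule zero) (auto intro: range_eqI[of _ _ "(0, 1)"])
    ultimately have "v = 0"
      by (simp add: a_def b_def vec_eq_iff complex_eq_iff)
    with v(1) show False ..
  qed
qed

text \<open>At a fixed point the filtering gain turns the Riccati equation into
  \<open>P = F V F\<^sup>T + K K\<^sup>T + B B\<^sup>T\<close> with \<open>F = A - K C\<close>, and \<open>V \<ge> P\<close> because \<open>\<theta> \<ge> 0\<close>.\<close>

lemma schur_stable_gain:
  fixes A :: "real^'n^'n" and C :: "real^'n^'p"
  assumes reach: "is_reachable A B" and \<theta>: "0 \<le> \<theta>"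
    and P: "pos_def P" "pos_def (V_inv \<theta> D P)" "riccati \<theta> A B C D P = P"
  shows "schur_stable (A - gain \<theta> A C D P ** C)"
proof (rule schur_stable_of_lyapunov_inequality[OF reach P(1)])
  fix z :: "real^'n"
  define V where "V = matrix_inv (V_inv \<theta> D P)"
  define W where "W = C ** V ** transpose C + mat 1"
  let ?K = "gain \<theta> A C D P" and ?M = "stage_info \<theta> C D P"
  have pdV: "pos_def V"
    unfolding V_def by (rule pos_def_matrix_inv[OF P(2)])
  have pdW: "pos_def W"
    unfolding W_def by (rule pos_def_innovation[OF pdV])
  have pdM: "pos_def ?M"
    by (rule pos_def_stage_info[OF P(2)])
  have VV: "V_inv \<theta> D P *v (V *v x) = x" for x
    by (simp add: V_def matrix_inv_vector pos_def_invertible[OF P(2)])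
  define e where "e = transpose A *v z"
  define k where "k = transpose ?K *v z"
  define f where "f = transpose (A - ?K ** C) *v z"
  have f: "f = e - transpose C *v k"
    by (simp add: f_def e_def k_def transpose_minus matrix_transpose_mul
        matrix_vector_mult_diff_rdistrib matrix_vector_mul_assoc)
  have "transpose ?K = matrix_inv W ** C ** V ** transpose A"
    by (simp add: gain_def Let_def V_def[symmetric] W_def[symmetric] matrix_transpose_mul matrix_mul_assoc
        pos_def_symmetric[OF pdV] pos_def_symmetric[OF pos_def_matrix_inv[OF pdW]])
  then have "k = matrix_inv W *v (C *v (V *v e))"
    by (simp add: k_def e_def matrix_vector_mul_assoc matrix_mul_assoc)
  then have "W *v k = C *v (V *v e)"
    by (simp add: matrix_inv_vector pos_def_invertible[OF pdW])
  then have "C *v (V *v (transpose C *v k)) + k = C *v (V *v e)"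
    by (simp add: W_def matrix_vector_mult_add_rdistrib matrix_vector_mul_assoc[symmetric])
  then have k: "C *v (V *v f) = k"
    by (simp add: f matrix_vector_mult_diff_distrib algebra_simps)
  have "?M *v (V *v f) = f + transpose C *v (C *v (V *v f))"
    by (simp add: stage_info_V_inv matrix_vector_mult_add_rdistrib VV matrix_vector_mul_assoc[symmetric])
  also have "\<dots> = e"
    unfolding k by (simp add: f)
  finally have Mf: "?M *v (V *v f) = e" .
  have "qform (matrix_inv ?M) e = qform ?M (V *v f)"
    unfolding Mf[symmetric]
    by (rule qform_matrix_inv[OF pos_def_invertible[OF pdM] pos_def_symmetric[OF pdM]])
  also have "\<dots> = qform (V_inv \<theta> D P) (V *v f) + k \<bullet> k"
    by (simp add: stage_info_V_inv qform_plus qform_gram k)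
  also have "qform (V_inv \<theta> D P) (V *v f) = qform V f"
    by (simp add: qform_def VV inner_commute)
  finally have "qform (matrix_inv ?M) e = qform V f + k \<bullet> k" .
  then have "qform P z = qform V f + k \<bullet> k + (transpose B *v z) \<bullet> (transpose B *v z)"
    using qform_riccati[of \<theta> A B C D P z] P(3) by (simp add: e_def)
  moreover have "qform P f \<le> qform V f"
  proof -
    have "qform (V_inv \<theta> D P) x \<le> qform (matrix_inv P) x" for x
      using \<theta> by (simp add: qform_V_inv)
    from qform_matrix_inv_antimono[OF P(2) pos_def_matrix_inv[OF P(1)] this, of f]
    show ?thesis
      by (simp add: V_def matrix_inv_matrix_inv pos_def_invertible[OF P(1)])
  qed
  ultimately show "qform P (transpose (A - ?K ** C) *v z) + (transpose ?K *v z) \<bullet> (transpose ?K *v z)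
      + (transpose B *v z) \<bullet> (transpose B *v z) \<le> qform P z"
    unfolding f_def[symmetric] k_def[symmetric] by linarith
qed

section \<open>Convergence of the risk-sensitive filter\<close>

theorem theorem2:
  fixes A :: "real^'n^'n" and B :: "real^'m^'n" and C :: "real^'n^'p" and D :: "real^'n^'q"
    and G :: "real^'p^'n" and \<rho> \<theta> :: real
  assumes "CARD('q) \<le> CARD('n)" and "rank D = CARD('q)"
    and "is_reachable A B" and "is_observable C A"
    and "CARD('k::{finite,linorder}) \<ge> CARD('n)"
    and "schur_stable (A - G ** C)"
    and "1 < \<rho>" and "spec_radius (A - G ** C) \<noteq> 0 \<longrightarrow> \<rho> < 1 / spec_radius (A - G ** C)"
    and "0 \<le> \<theta>" and "ereal \<theta> < tau_N TYPE('k) A B C D" and "\<theta> \<le> beta_rho \<rho> A B C D G"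
  shows "\<exists>P. (pos_def P \<and> pos_def (V_inv \<theta> D P) \<and> riccati \<theta> A B C D P = P)
    \<and> (\<forall>Q. pos_def Q \<and> pos_def (V_inv \<theta> D Q) \<and> riccati \<theta> A B C D Q = Q \<longrightarrow> Q = P)
    \<and> (\<forall>p. pos_def (p 0) \<and> loewner_le (p 0) (Sigma_rho \<rho> A B C G)
           \<and> (\<forall>t::nat. p (Suc t) = riccati \<theta> A B C D (p t)) \<longrightarrow>
         (\<forall>t. pos_def (p t) \<and> invertible (V_inv \<theta> D (p t)) \<and> pos_def (matrix_inv (V_inv \<theta> D (p t))))
         \<and> p \<longlonglongrightarrow> P
         \<and> (\<exists>K. (\<lambda>t. gain \<theta> A C D (p t)) \<longlonglongrightarrow> K \<and> schur_stable (A - K ** C)))"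
proof -
  note reach = \<open>is_reachable A B\<close> and \<theta> = \<open>0 \<le> \<theta>\<close>
  let ?S = "Sigma_rho \<rho> A B C G"
  note S = Sigma_rho_supersolution[OF reach \<open>1 < \<rho>\<close> assms(8) \<theta> assms(11)]
  obtain P where P: "pos_def P" "pos_def (V_inv \<theta> D P)" "riccati \<theta> A B C D P = P"
    and s: "(\<lambda>t. (riccati \<theta> A B C D ^^ t) ?S) \<longlonglongrightarrow> P"
    using supersolution_orbit_converges[OF reach \<theta> S] by blast
  obtain \<epsilon> where \<epsilon>: "0 < \<epsilon>" "\<And>x w. \<epsilon> * (x \<bullet> x) \<le> block_cost \<theta> A B C D x w CARD('k)"
    using block_cost_coercive[OF \<open>is_observable C A\<close> assms(5) \<theta> assms(10)] by blast
  have unique: "Q = P" if "pos_def Q" "pos_def (V_inv \<theta> D Q)" "riccati \<theta> A B C D Q = Q" for Q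
    by (rule riccati_fixed_point_unique[OF reach \<epsilon> zero_less_card_finite P that])
  have "(\<forall>t. pos_def (p t) \<and> invertible (V_inv \<theta> D (p t)) \<and> pos_def (matrix_inv (V_inv \<theta> D (p t))))
      \<and> p \<longlonglongrightarrow> P \<and> (\<exists>K. (\<lambda>t. gain \<theta> A C D (p t)) \<longlonglongrightarrow> K \<and> schur_stable (A - K ** C))"
    if p: "pos_def (p 0)" "loewner_le (p 0) ?S" "\<And>t. p (Suc t) = riccati \<theta> A B C D (p t)" for p
  proof -
    have p0: "qform (p 0) x \<le> qform ?S x" for x
      using p(1,2) by (simp add: loewner_le_iff pos_def_symmetric S(1))
    note orbit = orbit_below_supersolution[OF reach S p(1) p0 p(3)]
    have pd: "pos_def (p t)" "pos_def (V_inv \<theta> D (p t))" for t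
      using orbit(1) by (simp_all add: admissible_orbit_def)
    have lim: "p \<longlonglongrightarrow> P"
      by (rule orbit_converges[OF reach P \<epsilon> zero_less_card_finite orbit(1) s orbit(2)])
    have "(\<lambda>t. gain \<theta> A C D (p t)) \<longlonglongrightarrow> gain \<theta> A C D P"
      by (rule tendsto_gain[OF lim P(1) pd(1) P(2) pd(2)])
    with schur_stable_gain[OF reach \<theta> P] lim pd show ?thesis
      by (auto intro: pos_def_invertible pos_def_matrix_inv)
  qed
  with P unique show ?thesis by (intro exI[of _ P]) blast
qed

end
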